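(* Let $T$ be a quadratic starlike tree containing $K_{1,3}$ as a proper induced subgraph. Then $f_T(x)$ is of the form $$f_T(x)=x^{t_1}(x^2-1)^{t_2}(x^2-2)^{t_3}\big((x^2-x-1)(x^2+x-1)\big)^{t_4}(x^2-3)^{t_5}(x^2-ax+b)(x^2+ax+b),$$ with integers $t_1,\dots,t_5\ge0$, integers $a>0$ and $b$ such that $a^2-4b>0$ is not a perfect square, and $\lambda_1(T)$ a root of $x^2-ax+b$ (form (II)), if and only if $T$ is one of the following five graphs, where $a>0$, $b$ are integers with $a^2-4b>0$ not a perfect square satisfying the stated relations, and then $f_T(x)$ is as stated: (1) $T_{0,0,1,0,n_5}$ with $n_5=\frac{b^2-3}{2}\ge 2$ and $2a^2=(b+2)^2+1$; $f_T(x)=x^{n_5}(x^2-1)^{n_5-1}(x^2-x-1)(x^2+x-1)(x^2-3)^{n_5-1}(x^2-ax+b)(x^2+ax+b)$; (2) $T_{0,0,0,n_4}$ with $n_4=\frac{b^2-1}{2}\ge 3$ and $2a^2=(b+2)^2+1$; $f_T(x)=x\big((x^2-x-1)(x^2+x-1)\big)^{n_4-1}(x^2-ax+b)(x^2+ax+b)$; (3) $T_{2,0,0,n_4}$ with either $b=1$ and $n_4=a^2-5\ge 1$, or $b=-1$ and $n_4=a^2-1\ge1$; $f_T(x)=x(x^2-2)\big((x^2-x-1)(x^2+x-1)\big)^{n_4-1}(x^2-ax+b)(x^2+ax+b)$; (4) $T_{n_1,0,n_3}$ with $n_1=-a^2+(b+1)^2+1\ge 0$, $n_3=2a^2-(b+2)^2\ge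 1$, $n_1+n_3\ge 3$; $f_T(x)=x^{n_1+n_3-1}(x^2-2)^{n_3-1}(x^2-ax+b)(x^2+ax+b)$; (5) $T_{n_1,n_2}$ with $n_1=b^2\ge 1$, $n_2=a^2-(b+1)^2\ge 1$, $n_1+n_2\ge 3$; $f_T(x)=x^{n_1-1}(x^2-1)^{n_2-1}(x^2-ax+b)(x^2+ax+b)$.
   Context: All graphs are simple and connected; eigenvalues are those of the adjacency matrix, ordered $\lambda_1\ge\lambda_2\ge\cdots$, and $f_G(x)=\det(xI-A(G))$. A graph is quadratic if every eigenvalue is an algebraic integer of degree at most $2$, equivalently every irreducible factor over $\mathbb{Q}$ of its characteristic polynomial has degree at most $2$. $P_i$ denotes the path on $i$ vertices. The starlike tree $T_{n_1,\ldots,n_k}$ consists of a center vertex $u$ and $n_i$ pendant paths $P_i$ attached to $u$, i.e. $T-u=\bigcup_i n_iP_i$; trailing zero indices may be omitted. *)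

theory Defs
  imports
    "HOL-Computational_Algebra.Nth_Powers"
    "Jordan_Normal_Form.Char_Poly"
    "Graph_Theory.Graph_Theory"
begin

text \<open>
  Simple graphs are the symmetric, loop-free digraphs without parallel arcs of the locale
  \<^locale>\<open>graph\<close>; adjacency of \<open>u\<close> and \<open>v\<close> is \<open>u \<rightarrow>\<^bsub>G\<^esub> v\<close>.
\<close>

subsection \<open>Spectrum of a graph\<close>

text \<open>
  Matrices are indexed by natural numbers, so the vertices have to be listed in some order.
  Another order conjugates the adjacency matrix by a permutation matrix and hence does not change
  the eigenvalues or the characteristic polynomial.
\<close>

definition vertex_enum :: "('v, 'e) pre_digraph \<Rightarrow> 'v list" where
  "vertex_enum G = (SOME vs. distinct vs \<and> set vs = verts G)"

definition adj_matrix :: "('v, 'e) pre_digraph \<Rightarrow> 'r :: comm_ring_1 mat" where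
  "adj_matrix G = (let vs = vertex_enum G in
     mat (length vs) (length vs) (\<lambda>(i, j). if vs ! i \<rightarrow>\<^bsub>G\<^esub> vs ! j then 1 else 0))"

definition graph_char_poly :: "('v, 'e) pre_digraph \<Rightarrow> int poly" where
  "graph_char_poly G = char_poly (adj_matrix G)"

text \<open>The adjacency matrix is real symmetric, so all its eigenvalues are real.\<close>

definition graph_eigenvalue :: "('v, 'e) pre_digraph \<Rightarrow> real \<Rightarrow> bool" where
  "graph_eigenvalue G x \<longleftrightarrow> eigenvalue (adj_matrix G) x"

definition lambda1 :: "('v, 'e) pre_digraph \<Rightarrow> real" where
  "lambda1 G = Max {x. graph_eigenvalue G x}"

text \<open>Degree of the minimal polynomial over the rationals; only meaningful for algebraic \<open>x\<close>.\<close>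

definition algebraic_degree :: "real \<Rightarrow> nat" where
  "algebraic_degree x =
     (LEAST d. \<exists>p :: rat poly. p \<noteq> 0 \<and> degree p = d \<and> poly (map_poly of_rat p) x = 0)"

definition quadratic_graph :: "('v, 'e) pre_digraph \<Rightarrow> bool" where
  "quadratic_graph G \<longleftrightarrow>
     (\<forall>x. graph_eigenvalue G x \<longrightarrow> algebraic_int x \<and> algebraic_degree x \<le> 2)"

subsection \<open>Starlike trees\<close>

text \<open>
  \<open>Branch i j l\<close> is the \<open>l\<close>-th vertex, counted from the center, of the \<open>j\<close>-th pendant path
  with \<open>i\<close> vertices.  In \<open>starlike [n\<^sub>1, \<dots>, n\<^sub>k]\<close> the number \<open>n\<^sub>i\<close> of such paths is
  \<open>ns ! (i - 1)\<close>, as lists are indexed from 0.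
\<close>

datatype starlike_vertex = Center | Branch nat nat nat

definition starlike_edges :: "nat list \<Rightarrow> starlike_vertex rel" where
  "starlike_edges ns =
     {(Center, Branch i j 1) | i j. 1 \<le> i \<and> i \<le> length ns \<and> j < ns ! (i - 1)} \<union>
     {(Branch i j l, Branch i j (Suc l)) | i j l.
        1 \<le> i \<and> i \<le> length ns \<and> j < ns ! (i - 1) \<and> 1 \<le> l \<and> Suc l \<le> i}"

definition starlike :: "nat list \<Rightarrow> starlike_vertex pair_pre_digraph" where
  "starlike ns = \<lparr>
     pverts = {Center} \<union>
       {Branch i j l | i j l. 1 \<le> i \<and> i \<le> length ns \<and> j < ns ! (i - 1) \<and> 1 \<le> l \<and> l \<le> i},
     parcs = starlike_edges ns \<union> (starlike_edges ns)\<inverse> \<rparr>"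

definition is_T :: "('v, 'e) pre_digraph \<Rightarrow> nat list \<Rightarrow> bool" where
  "is_T T ns \<longleftrightarrow> digraph_iso T (with_proj (starlike ns))"

definition starlike_tree :: "('v, 'e) pre_digraph \<Rightarrow> bool" where
  "starlike_tree T \<longleftrightarrow> (\<exists>ns. is_T T ns)"

definition has_proper_induced_K13 :: "('v, 'e) pre_digraph \<Rightarrow> bool" where
  "has_proper_induced_K13 G \<longleftrightarrow>
     (\<exists>H. induced_subgraph H G \<and> verts H \<subset> verts G \<and> K\<^bsub>1,3\<^esub> H)"

subsection \<open>Form (II) and the five families\<close>

abbreviation \<X> :: "int poly" where
  "\<X> \<equiv> [:0, 1:]"

abbreviation quad :: "int \<Rightarrow> int \<Rightarrow> int poly" where
  "quad a b \<equiv> \<X>^2 - [:a:] * \<X> + [:b:]"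

abbreviation quad' :: "int \<Rightarrow> int \<Rightarrow> int poly" where
  "quad' a b \<equiv> \<X>^2 + [:a:] * \<X> + [:b:]"

definition admissible :: "int \<Rightarrow> int \<Rightarrow> bool" where
  "admissible a b \<longleftrightarrow> a > 0 \<and> a^2 - 4 * b > 0 \<and> \<not> is_square (a^2 - 4 * b)"

definition form_II :: "('v, 'e) pre_digraph \<Rightarrow> bool" where
  "form_II T \<longleftrightarrow> (\<exists>(t1::nat) (t2::nat) (t3::nat) (t4::nat) (t5::nat) a b.
     admissible a b \<and>
     graph_char_poly T =
       \<X>^t1 * (\<X>^2 - 1)^t2 * (\<X>^2 - 2)^t3 * ((\<X>^2 - \<X> - 1) * (\<X>^2 + \<X> - 1))^t4
         * (\<X>^2 - 3)^t5 * quad a b * quad' a b \<and>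
     poly (map_poly real_of_int (quad a b)) (lambda1 T) = 0)"

definition family1 :: "('v, 'e) pre_digraph \<Rightarrow> int \<Rightarrow> int \<Rightarrow> nat \<Rightarrow> bool" where
  "family1 T a b n5 \<longleftrightarrow> is_T T [0, 0, 1, 0, n5] \<and>
     real n5 = (real_of_int b ^ 2 - 3) / 2 \<and> n5 \<ge> 2 \<and> 2 * a^2 = (b + 2)^2 + 1"

definition family2 :: "('v, 'e) pre_digraph \<Rightarrow> int \<Rightarrow> int \<Rightarrow> nat \<Rightarrow> bool" where
  "family2 T a b n4 \<longleftrightarrow> is_T T [0, 0, 0, n4] \<and>
     real n4 = (real_of_int b ^ 2 - 1) / 2 \<and> n4 \<ge> 3 \<and> 2 * a^2 = (b + 2)^2 + 1"

definition family3 :: "('v, 'e) pre_digraph \<Rightarrow> int \<Rightarrow> int \<Rightarrow> nat \<Rightarrow> bool" where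
  "family3 T a b n4 \<longleftrightarrow> is_T T [2, 0, 0, n4] \<and>
     (b = 1 \<and> int n4 = a^2 - 5 \<and> n4 \<ge> 1 \<or> b = -1 \<and> int n4 = a^2 - 1 \<and> n4 \<ge> 1)"

definition family4 :: "('v, 'e) pre_digraph \<Rightarrow> int \<Rightarrow> int \<Rightarrow> nat \<Rightarrow> nat \<Rightarrow> bool" where
  "family4 T a b n1 n3 \<longleftrightarrow> is_T T [n1, 0, n3] \<and>
     int n1 = - (a^2) + (b + 1)^2 + 1 \<and> n1 \<ge> 0 \<and>
     int n3 = 2 * a^2 - (b + 2)^2 \<and> n3 \<ge> 1 \<and> n1 + n3 \<ge> 3"

definition family5 :: "('v, 'e) pre_digraph \<Rightarrow> int \<Rightarrow> int \<Rightarrow> nat \<Rightarrow> nat \<Rightarrow> bool" where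
  "family5 T a b n1 n2 \<longleftrightarrow> is_T T [n1, n2] \<and>
     int n1 = b^2 \<and> n1 \<ge> 1 \<and> int n2 = a^2 - (b + 1)^2 \<and> n2 \<ge> 1 \<and> n1 + n2 \<ge> 3"

end

theory Submission
  imports Defs
begin

text \<open>
  Expanding along pendant vertices, the starlike tree with branches of lengths \<open>b\<close> has characteristic
  polynomial \<open>(\<Prod>b. p\<^sub>b) (x - (\<Sum>b. p\<^bsub>b-1\<^esub> / p\<^sub>b))\<close>, where \<open>p\<^sub>b\<close> is the characteristic polynomial of
  the path on \<open>b\<close> vertices.  The rational function is strictly increasing between its poles, so a
  root common to \<open>m \<ge> 1\<close> branches has multiplicity exactly \<open>m - 1\<close>, and any other number is at most
  a simple root.  In form (II) this is applied to \<open>0\<close>, \<open>1\<close>, \<open>\<surd>2\<close>, \<open>\<surd>3\<close> and the golden ratio, which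
  cannot be roots of the irreducible quadratic factors; the exception \<open>x\<^sup>2 - x - 1\<close> is ruled out by
  \<open>\<lambda>\<^sub>1\<close>.  The exponents are thus determined by the number of branches of each length, and
  comparing degrees bounds the branch lengths by \<open>13\<close>.  The remaining linear system in the numbers of
  branches has exactly the five families as solutions, apart from \<open>n\<^sub>2 = 1, n\<^sub>4 \<ge> 2\<close>, where
  \<open>a\<^sup>2 = (b + 1)\<^sup>2 + 1\<close> is impossible.
\<close>

section \<open>Path polynomials and starlike polynomials\<close>

text \<open>In the variable \<open>x = 2 cos t\<close> the polynomial \<open>p\<^sub>n\<close> is
  the Chebyshev quotient \<open>sin ((n+1) t) / sin t\<close>. Up to sign and conjugation the five
  special numbers are the eigenvalues of the paths with at most 5 vertices. Lengths 1 to 5 therefore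
  do not weigh on the degree count, whereas a longer branch brings in a positive degree that must be
  absorbed by the two quadratic factors and by the deviations of the multiplicities from the branch
  numbers. For the converse the factorization is a computation in which \<open>a\<close> and
  \<open>b\<close> enter only through \<open>a^2 - 2b\<close> and \<open>b^2\<close>. What remains
  is to place \<open>\<lambda>\<^sub>1\<close> on the factor \<open>x^2 - ax + b\<close>: its larger
  root is shown to be at least 2, which no special eigenvalue exceeds. On the formal side, matrices
  are indexed by natural numbers in an order fixed by choice, while the recursion deletes vertices;
  determinants over finite sets bridge the two.\<close>

fun path_poly :: "nat \<Rightarrow> 'a::comm_ring_1 poly" where
  "path_poly 0 = 1"
| "path_poly (Suc 0) = [:0, 1:]"
| "path_poly (Suc (Suc n)) = [:0, 1:] * path_poly (Suc n) - path_poly n"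

definition paths_poly :: "nat list \<Rightarrow> 'a::comm_ring_1 poly" where
  "paths_poly bs = prod_list (map path_poly bs)"

text \<open>The step removes the edge from the center to a branch of length \<open>b\<close>; the
  subtracted term is the forest left without the center and the first vertex of that branch. For
  \<open>b = 0\<close> truncated subtraction would subtract a term that does not belong there, hence
  the hypothesis \<open>b \<ge> 1\<close> in what follows.\<close>

fun starlike_poly :: "nat list \<Rightarrow> 'a::comm_ring_1 poly" where
  "starlike_poly [] = [:0, 1:]"
| "starlike_poly (b # bs) = path_poly b * starlike_poly bs - path_poly (b - 1) * paths_poly bs"

lemma paths_poly_simps [simp]:
  "paths_poly [] = 1"
  "paths_poly (b # bs) = path_poly b * paths_poly bs"
  by (simp_all add: paths_poly_def)

lemma paths_poly_append [simp]: "paths_poly (as @ bs) = paths_poly as * paths_poly bs"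
  by (simp add: paths_poly_def)

lemma paths_poly_replicate [simp]: "paths_poly (replicate n b) = path_poly b ^ n"
  by (simp add: paths_poly_def prod_list_replicate)

text \<open>All but one copy of the common path factor split off. This is the source of the powers
  in the characteristic polynomials of the families.\<close>

lemma starlike_poly_replicate_append:
  "starlike_poly (replicate (Suc n) b @ bs) =
     path_poly b ^ n *
       (path_poly b * starlike_poly bs - of_nat (Suc n) * path_poly (b - 1) * paths_poly bs)"
proof (induction n)
  case (Suc n)
  have eq: "starlike_poly (replicate (Suc (Suc n)) b @ bs) =
      path_poly b * starlike_poly (replicate (Suc n) b @ bs)
        - path_poly (b - 1) * path_poly b ^ Suc n * paths_poly bs"
    by (simp only: replicate_Suc[of "Suc n"] append_Cons starlike_poly.simps paths_poly_append
        paths_poly_replicate mult.assoc)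
  show ?case
    unfolding eq Suc by (simp add: algebra_simps)
qed (simp add: algebra_simps)

lemma lead_coeff_path_poly:
  "degree (path_poly n :: 'a::{comm_ring_1,ring_no_zero_divisors} poly) = n \<and>
   coeff (path_poly n :: 'a poly) n = 1"
proof (induction n rule: path_poly.induct)
  case (3 n)
  let ?p = "[:0, 1:] * path_poly (Suc n) :: 'a poly"
  have "path_poly (Suc n) \<noteq> (0 :: 'a poly)"
    using 3(1) by auto
  then have "degree ?p = Suc (Suc n)"
    using 3(1) by simp
  moreover have "coeff ?p (Suc (Suc n)) = 1"
    using 3(1) by simp
  moreover have "coeff (path_poly n :: 'a poly) (Suc (Suc n)) = 0"
    using 3(2) by (intro coeff_eq_0) simp
  moreover have "degree (path_poly n :: 'a poly) < degree ?p"
    using 3(2) \<open>degree ?p = _\<close> by simp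
  then have "degree (?p - path_poly n) = degree ?p"
    using degree_add_eq_left[of "- path_poly n" ?p] by simp
  ultimately show ?case
    by simp
qed auto

lemma degree_path_poly [simp]:
  "degree (path_poly n :: 'a::{comm_ring_1,ring_no_zero_divisors} poly) = n"
  using lead_coeff_path_poly by blast

lemma path_poly_nonzero [simp]: "path_poly n \<noteq> (0 :: 'a::{comm_ring_1,ring_no_zero_divisors} poly)"
  using lead_coeff_path_poly[of n, where ?'a = 'a] by auto

lemma paths_poly_nonzero [simp]: "paths_poly bs \<noteq> (0 :: 'a::idom poly)"
  by (induction bs) simp_all

lemma degree_paths_poly [simp]: "degree (paths_poly bs :: 'a::idom poly) = sum_list bs"
  by (induction bs) (simp_all add: degree_mult_eq)

lemma degree_starlike_poly:
  assumes "\<forall>b\<in>set bs. b \<ge> 1"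
  shows "degree (starlike_poly bs :: 'a::idom poly) = Suc (sum_list bs)"
  using assms
proof (induction bs)
  case (Cons b bs)
  let ?p = "path_poly b * starlike_poly bs :: 'a poly"
  have "starlike_poly bs \<noteq> (0 :: 'a poly)"
    using Cons by auto
  then have "degree ?p = Suc (b + sum_list bs)"
    using Cons by (simp add: degree_mult_eq)
  moreover have "degree (path_poly (b - 1) * paths_poly bs :: 'a poly) < Suc (b + sum_list bs)"
    by (simp add: degree_mult_eq)
  ultimately show ?case
    using degree_add_eq_left[of "- (path_poly (b - 1) * paths_poly bs)" ?p] by simp
qed simp

lemma starlike_poly_nonzero:
  "\<forall>b\<in>set bs. b \<ge> 1 \<Longrightarrow> starlike_poly bs \<noteq> (0 :: 'a::idom poly)"
  using degree_starlike_poly[of bs, where ?'a = 'a] by auto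

lemma of_int_path_poly: "map_poly real_of_int (path_poly n) = path_poly n"
  by (induction n rule: path_poly.induct)
     (simp_all add: of_int_poly_hom.hom_minus of_int_poly_hom.hom_add)

lemma of_int_paths_poly: "map_poly real_of_int (paths_poly bs) = paths_poly bs"
  by (induction bs) (simp_all add: of_int_path_poly of_int_poly_hom.hom_mult)

lemma of_int_starlike_poly: "map_poly real_of_int (starlike_poly bs) = starlike_poly bs"
  by (induction bs)
     (simp_all add: of_int_path_poly of_int_paths_poly of_int_poly_hom.hom_mult of_int_poly_hom.hom_minus)


section \<open>Multiplicities of roots\<close>

lemma path_poly_wronskian:
  fixes x :: real
  assumes "b \<ge> 1"
  shows "poly (pderiv (path_poly b)) x * poly (path_poly (b - 1)) x
           - poly (path_poly b) x * poly (pderiv (path_poly (b - 1))) x \<ge> 1"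
proof -
  have "poly (pderiv (path_poly (Suc n))) x * poly (path_poly n) x
           - poly (path_poly (Suc n)) x * poly (pderiv (path_poly n)) x \<ge> 1" for n
  proof (induction n)
    case (Suc n)
    have "poly (pderiv (path_poly (Suc (Suc n)))) x * poly (path_poly (Suc n)) x
           - poly (path_poly (Suc (Suc n))) x * poly (pderiv (path_poly (Suc n))) x
         = (poly (path_poly (Suc n)) x)^2 + (poly (pderiv (path_poly (Suc n))) x * poly (path_poly n) x
           - poly (path_poly (Suc n)) x * poly (pderiv (path_poly n)) x)"
      by (simp add: pderiv_diff pderiv_mult pderiv_pCons algebra_simps power2_eq_square)
    then show ?case
      using Suc by (smt (verit) zero_le_power2)
  qed (simp add: pderiv_pCons)
  from this[of "b - 1"] show ?thesis
    using assms by simp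
qed

definition root_count :: "real \<Rightarrow> nat list \<Rightarrow> nat" where
  "root_count x bs = length (filter (\<lambda>b. poly (path_poly b) x = 0) bs)"

lemma root_count_simps [simp]:
  "root_count x [] = 0"
  "root_count x (b # bs) = (if poly (path_poly b) x = 0 then Suc (root_count x bs) else root_count x bs)"
  by (simp_all add: root_count_def)

text \<open>
  The quotient of \<^term>\<open>starlike_poly bs\<close> by \<^term>\<open>paths_poly bs\<close> is
  \<open>x - (\<Sum>b. p\<^bsub>b-1\<^esub> / p\<^sub>b)\<close>, whose residues at the poles all have the same sign and hence cannot
  cancel.
\<close>
lemma starlike_poly_factor:
  fixes e :: real
  assumes "\<forall>b\<in>set bs. b \<ge> 1"
  shows "\<exists>Q R. paths_poly bs = [:-e, 1:] ^ root_count e bs * Q \<and> poly Q e \<noteq> 0 \<and>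
    (root_count e bs \<ge> 1 \<longrightarrow>
       starlike_poly bs = [:-e, 1:] ^ (root_count e bs - 1) * R \<and> poly Q e * poly R e < 0)"
  using assms
proof (induction bs)
  case Nil
  show ?case by (intro exI[of _ 1]) simp
next
  case (Cons b bs)
  define m where "m = root_count e bs"
  obtain Q R where Q: "paths_poly bs = [:-e, 1:] ^ m * Q" "poly Q e \<noteq> 0"
    and R: "m \<ge> 1 \<Longrightarrow> starlike_poly bs = [:-e, 1:] ^ (m - 1) * R"
           "m \<ge> 1 \<Longrightarrow> poly Q e * poly R e < 0"
    using Cons unfolding m_def by auto
  show ?case
  proof (cases "poly (path_poly b) e = 0")
    case False
    let ?Q = "path_poly b * Q"
    let ?R = "path_poly b * R - path_poly (b - 1) * ([:-e, 1:] * Q)"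
    have "starlike_poly (b # bs) = [:-e, 1:] ^ (m - 1) * ?R" if "m \<ge> 1"
    proof -
      have "[:-e, 1:] ^ m = [:-e, 1:] ^ (m - 1) * [:-e, 1:]"
        using that by (metis power_minus_mult not_one_le_zero not_gr_zero)
      then have "paths_poly bs = [:-e, 1:] ^ (m - 1) * ([:-e, 1:] * Q)"
        using Q(1) by (simp only: mult.assoc)
      then show ?thesis
        by (simp only: starlike_poly.simps R(1)[OF that] right_diff_distrib mult_ac)
    qed
    moreover have eq: "poly ?Q e * poly ?R e = (poly (path_poly b) e)^2 * (poly Q e * poly R e)"
      by (simp add: power2_eq_square algebra_simps)
    have "poly ?Q e * poly ?R e < 0" if "m \<ge> 1"
      unfolding eq by (rule mult_pos_neg) (use R(2)[OF that] False in simp_all)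
    ultimately show ?thesis
      using False Q by (intro exI[of _ ?Q] exI[of _ ?R]) (auto simp: m_def[symmetric] mult_ac)
  next
    case True
    then obtain h where h: "path_poly b = [:-e, 1:] * h"
      using poly_eq_0_iff_dvd[of "path_poly b" e] by (auto elim: dvdE)
    \<comment> \<open>At the root \<open>e\<close> the Wronskian reduces to the product of
      \<open>h\<close> and \<open>path_poly (b - 1)\<close> at \<open>e\<close>. Its positivity says
      that the root is simple and that the residue of the ratio is positive.\<close>
    have "poly (pderiv (path_poly b)) e = poly h e"
      unfolding h by (simp add: pderiv_mult pderiv_pCons del: mult_pCons_left)
    then have pos: "poly h e * poly (path_poly (b - 1)) e > 0"
      using path_poly_wronskian[of b e] Cons.prems True by auto
    then have h0: "poly h e \<noteq> 0"
      by auto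
    let ?Q = "h * Q"
    have Q': "paths_poly (b # bs) = [:-e, 1:] ^ Suc m * ?Q"
      by (simp only: paths_poly_simps h Q(1) power_Suc mult_ac)
    show ?thesis
    proof (cases "m \<ge> 1")
      case m: True
      let ?R = "h * R - path_poly (b - 1) * Q"
      have *: "[:-e, 1:] * [:-e, 1:] ^ (m - 1) = [:-e, 1:] ^ m"
        using m by (metis power_eq_if not_one_le_zero)
      have "starlike_poly (b # bs) =
          ([:-e, 1:] * [:-e, 1:] ^ (m - 1)) * (h * R) - path_poly (b - 1) * ([:-e, 1:] ^ m * Q)"
        by (simp only: starlike_poly.simps R(1)[OF m] h Q(1) mult_ac)
      also have "\<dots> = [:-e, 1:] ^ m * ?R"
        by (simp only: * right_diff_distrib mult_ac)
      finally have "starlike_poly (b # bs) = [:-e, 1:] ^ m * ?R" .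
      \<comment> \<open>The residues collected so far and the residue of the new branch enter with
        the same sign, so the invariant stays negative.\<close>
      moreover have "poly ?Q e * poly ?R e = (poly h e)^2 * (poly Q e * poly R e)
          - (poly h e * poly (path_poly (b - 1)) e) * (poly Q e)^2"
        by (simp add: power2_eq_square algebra_simps)
      moreover have "(poly h e)^2 * (poly Q e * poly R e) < 0"
        using R(2)[OF m] h0 by (simp add: mult_pos_neg)
      moreover have "(poly h e * poly (path_poly (b - 1)) e) * (poly Q e)^2 > 0"
        using pos Q(2) by simp
      ultimately show ?thesis
        using True Q' Q(2) h0
        by (intro exI[of _ ?Q] exI[of _ ?R]) (auto simp: m_def[symmetric] simp del: starlike_poly.simps power_Suc paths_poly_simps)
    next
      case m: False
      then have m0: "m = 0" by simp
      \<comment> \<open>This is the first pole at \<open>e\<close>: the exponent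
        \<open>Suc m - 1\<close> is 0, so nothing is divided out.\<close>
      let ?R = "starlike_poly (b # bs)"
      have "poly ?Q e * poly ?R e = - ((poly h e * poly (path_poly (b - 1)) e) * (poly Q e)^2)"
        using True Q(1) m0 by (simp add: power2_eq_square algebra_simps)
      moreover have "(poly h e * poly (path_poly (b - 1)) e) * (poly Q e)^2 > 0"
        using pos Q(2) by simp
      ultimately have "poly ?Q e * poly ?R e < 0"
        by simp
      then show ?thesis
        using True Q' Q(2) h0 m0
        by (intro exI[of _ ?Q] exI[of _ ?R]) (auto simp: m_def[symmetric] simp del: starlike_poly.simps power_Suc paths_poly_simps)
    qed
  qed
qed

lemma order_starlike_poly:
  fixes e :: real
  assumes "\<forall>b\<in>set bs. b \<ge> 1" "root_count e bs \<ge> 1"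
  shows "order e (starlike_poly bs) = root_count e bs - 1"
proof -
  obtain R where R: "starlike_poly bs = [:-e, 1:] ^ (root_count e bs - 1) * R" "poly R e \<noteq> 0"
    using starlike_poly_factor[of bs e] assms by fastforce
  show ?thesis
    using R(2) starlike_poly_nonzero[OF assms(1), where ?'a = real] order_0I[OF R(2)]
    unfolding R(1) by (simp add: order_mult order_power_n_n)
qed

text \<open>This is the numerator of the derivative of
  \<open>starlike_poly bs / paths_poly bs\<close>. A further branch multiplies it by a positive
  square and adds a nonnegative multiple of the Wronskian of that branch.\<close>

lemma starlike_poly_wronskian:
  fixes x :: real
  assumes "\<forall>b\<in>set bs. b \<ge> 1" "root_count x bs = 0"
  shows "poly (pderiv (starlike_poly bs)) x * poly (paths_poly bs) x
           - poly (starlike_poly bs) x * poly (pderiv (paths_poly bs)) x > 0"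
  using assms
proof (induction bs)
  case (Cons b bs)
  let ?p = "poly (path_poly b) x" and ?u = "poly (path_poly (b - 1)) x"
  let ?p' = "poly (pderiv (path_poly b)) x" and ?u' = "poly (pderiv (path_poly (b - 1))) x"
  let ?R = "poly (starlike_poly bs) x" and ?Q = "poly (paths_poly bs) x"
  let ?R' = "poly (pderiv (starlike_poly bs)) x" and ?Q' = "poly (pderiv (paths_poly bs)) x"
  have "?p \<noteq> 0" "root_count x bs = 0"
    using Cons.prems by (auto split: if_splits)
  then have "?p^2 * (?R' * ?Q - ?R * ?Q') > 0"
    using Cons by simp
  moreover have "?Q^2 * (?p' * ?u - ?p * ?u') \<ge> 0"
    using path_poly_wronskian[of b x] Cons.prems by simp
  moreover have "poly (pderiv (starlike_poly (b # bs))) x * poly (paths_poly (b # bs)) x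
        - poly (starlike_poly (b # bs)) x * poly (pderiv (paths_poly (b # bs))) x =
      ?p^2 * (?R' * ?Q - ?R * ?Q') + ?Q^2 * (?p' * ?u - ?p * ?u')"
    by (simp add: pderiv_diff pderiv_mult algebra_simps power2_eq_square)
  ultimately show ?case by linarith
qed (simp add: pderiv_pCons)

text \<open>At a root that is not a pole, the Wronskian reduces to the derivative times
  \<open>paths_poly bs\<close>; being positive, it forces the derivative to be nonzero.\<close>

lemma order_starlike_poly_le_1:
  fixes e :: real
  assumes "\<forall>b\<in>set bs. b \<ge> 1" "root_count e bs = 0"
  shows "order e (starlike_poly bs) = (if poly (starlike_poly bs) e = 0 then 1 else 0)"
proof (cases "poly (starlike_poly bs) e = 0")
  case True
  then have "poly (pderiv (starlike_poly bs)) e \<noteq> 0"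
    using starlike_poly_wronskian[OF assms] by auto
  then have "order e (pderiv (starlike_poly bs)) = 0"
    by (rule order_0I)
  moreover have "order e (starlike_poly bs) \<noteq> 0"
    using True starlike_poly_nonzero[OF assms(1), where ?'a = real] by (simp add: order_root)
  ultimately show ?thesis
    using True order_pderiv[of "starlike_poly bs" e] starlike_poly_nonzero[OF assms(1), where ?'a = real]
    by simp
qed (simp add: order_0I)

lemma poly_starlike_poly:
  fixes x :: real
  assumes "root_count x bs = 0"
  shows "poly (starlike_poly bs) x = poly (paths_poly bs) x *
    (x - (\<Sum>b\<leftarrow>bs. poly (path_poly (b - 1)) x / poly (path_poly b) x))"
  using assms
proof (induction bs)
  case (Cons b bs)
  let ?S = "\<Sum>b\<leftarrow>bs. poly (path_poly (b - 1)) x / poly (path_poly b) x"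
  have b: "poly (path_poly b) x \<noteq> 0"
    using Cons.prems by (auto split: if_splits)
  have "poly (starlike_poly (b # bs)) x = poly (path_poly b) x * (poly (paths_poly bs) x * (x - ?S))
      - poly (path_poly (b - 1)) x * poly (paths_poly bs) x"
    using Cons by (simp split: if_splits)
  also have "\<dots> = poly (path_poly b) x * poly (paths_poly bs) x *
      (x - (poly (path_poly (b - 1)) x / poly (path_poly b) x + ?S))"
    using b by (simp add: algebra_simps)
  finally show ?case
    by simp
qed simp

lemma poly_paths_poly_nonzero: "root_count x bs = 0 \<Longrightarrow> poly (paths_poly bs) x \<noteq> 0"
  by (induction bs) (auto split: if_splits)

text \<open>The recursion is determined by two consecutive values, and the hypotheses make the
  values at \<open>n + 1\<close> and \<open>n + 2\<close> the negatives of those at 0 and 1. For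
  \<open>t = \<pi> / (n + 1)\<close> this is \<open>sin (u + \<pi>) = - sin u\<close>.\<close>

lemma poly_path_poly_antiperiodic:
  fixes x :: real
  assumes "poly (path_poly n) x = 0" "poly (path_poly (Suc n)) x = -1"
  shows "poly (path_poly (i + Suc n)) x = - poly (path_poly i) x"
proof (induction i rule: path_poly.induct)
  case 1
  then show ?case using assms by simp
next
  case 2
  then show ?case using assms by simp
next
  case (3 i)
  have "poly (path_poly (Suc (Suc i) + Suc n)) x
      = x * poly (path_poly (Suc i + Suc n)) x - poly (path_poly (i + Suc n)) x"
    by simp
  then show ?case
    unfolding 3 by simp
qed

lemma poly_path_poly_eq_0_iff:
  fixes x :: real
  assumes "poly (path_poly n) x = 0" "poly (path_poly (Suc n)) x = -1"
    and "\<And>i. i < n \<Longrightarrow> poly (path_poly i) x \<noteq> 0"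
  shows "poly (path_poly i) x = 0 \<longleftrightarrow> Suc n dvd Suc i"
proof (induction i rule: less_induct)
  case (less i)
  consider "i < n" | "i = n" | "i \<ge> Suc n"
    by linarith
  then show ?case
  proof cases
    case 1
    then show ?thesis
      using assms(3) by (auto dest: dvd_imp_le)
  next
    case 3
    then obtain j where j: "i = j + Suc n"
      using le_Suc_ex add.commute by metis
    then have "poly (path_poly i) x = 0 \<longleftrightarrow> Suc n dvd Suc j"
      using less.IH[of j] poly_path_poly_antiperiodic[OF assms(1,2)] by simp
    then show ?thesis
      unfolding j by (metis add_Suc dvd_add_left_iff dvd_refl)
  qed (use assms(1) in simp)
qed

section \<open>Determinants indexed by finite sets\<close>

text \<open>
  Indexing by an arbitrary finite set makes deletion of vertices and independence of the vertex order
  immediate.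
\<close>
definition set_det :: "'a set \<Rightarrow> ('a \<Rightarrow> 'a \<Rightarrow> 'b::comm_ring_1) \<Rightarrow> 'b" where
  "set_det S M = (\<Sum>p | p permutes S. of_int (sign p) * (\<Prod>i\<in>S. M i (p i)))"

lemma set_det_empty [simp]: "set_det {} M = 1"
  by (simp add: set_det_def)

lemma set_det_cong:
  assumes "\<And>i j. i \<in> S \<Longrightarrow> j \<in> S \<Longrightarrow> M i j = N i j"
  shows "set_det S M = set_det S N"
  unfolding set_det_def
  by (intro sum.cong refl arg_cong2[where f = "(*)"] prod.cong assms) (auto simp: permutes_in_image)

text \<open>Conjugation with \<open>f\<close> matches the permutations of both sets and keeps the
  sign. It gives both independence of the vertex order and invariance under isomorphism.\<close>

lemma set_det_reindex:
  assumes "bij_betw f S S'" "finite S"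
  shows "set_det S' M = set_det S (\<lambda>i j. M (f i) (f j))"
  unfolding set_det_def
proof (rule sum.reindex_bij_witness[of _ "map_permutation S f" "map_permutation S' (inv_into S f)"])
  have inj: "inj_on f S" and S': "f ` S = S'"
    using assms by (auto simp: bij_betw_def)
  have inv: "bij_betw (inv_into S f) S' S"
    using assms(1) by (rule bij_betw_inv_into)
  fix p assume p: "p \<in> {p. p permutes S'}"
  then show "map_permutation S' (inv_into S f) p \<in> {p. p permutes S}"
    using map_permutation_permutes[OF inv] by simp
  show *: "map_permutation S f (map_permutation S' (inv_into S f) p) = p"
    using p map_permutation_compose_inv[OF inv] S' by (simp add: f_inv_into_f)
  let ?q = "map_permutation S' (inv_into S f) p"
  have fq: "f (?q i) = p (f i)" if "i \<in> S" for i
    using map_permutation_apply[OF inj that, of ?q] * by simp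
  have "sign ?q = sign p"
    using p inv assms by (intro sign_map_permutation) (auto simp: bij_betw_def bij_betw_finite[OF assms(1)])
  moreover have "(\<Prod>i\<in>S. M (f i) (f (?q i))) = (\<Prod>i\<in>S'. M i (p i))"
    using fq by (simp add: S'[symmetric] prod.reindex[OF inj])
  ultimately show "of_int (sign ?q) * (\<Prod>i\<in>S. M (f i) (f (?q i))) = of_int (sign p) * (\<Prod>i\<in>S'. M i (p i))"
    by simp
next
  fix q assume q: "q \<in> {p. p permutes S}"
  then show "map_permutation S f q \<in> {p. p permutes S'}"
    using map_permutation_permutes[OF assms(1)] by simp
  show "map_permutation S' (inv_into S f) (map_permutation S f q) = q"
    using q assms(1) by (intro map_permutation_compose_inv) (auto simp: bij_betw_def)
qed

lemma det_eq_set_det: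
  "A \<in> carrier_mat n n \<Longrightarrow> Determinant.det A = set_det {0..<n} (\<lambda>i j. A $$ (i, j))"
  by (simp add: Determinant.det_def set_det_def)

text \<open>Permutations of \<open>insert v S\<close> are sorted by the image \<open>b\<close> of
  \<open>v\<close>: each is the transposition of \<open>v\<close> and \<open>b\<close> after a
  unique permutation of \<open>S\<close>.\<close>

lemma set_det_insert:
  assumes "finite S" "v \<notin> S"
  shows "set_det (insert v S) M =
    (\<Sum>b\<in>insert v S. M v b *
       (\<Sum>q | q permutes S. of_int (sign (Transposition.transpose v b \<circ> q)) * (\<Prod>i\<in>S. M i (Transposition.transpose v b (q i)))))"
proof -
  have "set_det (insert v S) M = (\<Sum>b\<in>insert v S. \<Sum>q | q permutes S.
      of_int (sign (Transposition.transpose v b \<circ> q)) *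
      (\<Prod>i\<in>insert v S. M i ((Transposition.transpose v b \<circ> q) i)))"
    unfolding set_det_def using assms by (subst sum_over_permutations_insert) auto
  also have "\<dots> = (\<Sum>b\<in>insert v S. M v b *
       (\<Sum>q | q permutes S. of_int (sign (Transposition.transpose v b \<circ> q)) * (\<Prod>i\<in>S. M i (Transposition.transpose v b (q i)))))"
    unfolding sum_distrib_left
    using assms by (intro sum.cong refl) (auto simp: permutes_not_in mult_ac)
  finally show ?thesis .
qed

lemma set_det_isolated:
  assumes "finite S" "v \<notin> S" "\<And>j. j \<in> S \<Longrightarrow> M v j = 0"
  shows "set_det (insert v S) M = M v v * set_det S M"
  unfolding set_det_insert[OF assms(1,2)] using assms
  by (simp add: set_det_def)

text \<open>For the entries of \<open>xI - A\<close> this is the recurrence for a pendant vertex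
  \<open>v\<close> with neighbor \<open>u\<close>: \<open>x\<close> times the polynomial without
  \<open>v\<close>, minus the one without \<open>u\<close> and \<open>v\<close>.\<close>

lemma set_det_pendant:
  assumes "finite S" "v \<notin> S" "u \<notin> S" "u \<noteq> v"
    and "\<And>j. j \<in> S \<Longrightarrow> M v j = 0" "\<And>j. j \<in> S \<Longrightarrow> M j v = 0"
  shows "set_det (insert v (insert u S)) M =
    M v v * set_det (insert u S) M - M v u * M u v * set_det S M"
proof -
  let ?t = "Transposition.transpose v u"
  \<comment> \<open>If \<open>u\<close> is not sent to \<open>v\<close>, then some row in
    \<open>S\<close> is, and its entry in column \<open>v\<close> is 0.\<close>
  have zero: "(\<Prod>i\<in>S. M i (?t (Transposition.transpose u c (r i)))) = 0"
    if "c \<in> S" "r permutes S" for c r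
  proof -
    have "c \<in> r ` S"
      using that by (simp add: permutes_image)
    then obtain i where "i \<in> S" "r i = c"
      by blast
    then have "M i (?t (Transposition.transpose u c (r i))) = 0"
      using assms by simp
    then show ?thesis
      using \<open>i \<in> S\<close> assms(1) by (meson prod_zero)
  qed
  have "(\<Sum>q | q permutes insert u S. of_int (sign (?t \<circ> q)) * (\<Prod>i\<in>insert u S. M i (?t (q i))))
     = (\<Sum>c\<in>insert u S. \<Sum>r | r permutes S. of_int (sign (?t \<circ> (Transposition.transpose u c \<circ> r))) *
         (\<Prod>i\<in>insert u S. M i (?t (Transposition.transpose u c (r i)))))"
    using assms by (subst sum_over_permutations_insert) auto
  also have "\<dots> = (\<Sum>r | r permutes S. of_int (sign (?t \<circ> r)) * (M u v * (\<Prod>i\<in>S. M i (?t (r i)))))"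
  proof -
    define F where "F = (\<lambda>c. \<Sum>r | r permutes S. of_int (sign (?t \<circ> (Transposition.transpose u c \<circ> r))) *
         (\<Prod>i\<in>insert u S. M i (?t (Transposition.transpose u c (r i)))))"
    have "F c = 0" if "c \<in> S" for c
      unfolding F_def using assms(1,3) zero[OF that] by (intro sum.neutral) simp
    then have "sum F (insert u S) = F u"
      using assms(1,3) by simp
    also have "F u = (\<Sum>r | r permutes S. of_int (sign (?t \<circ> r)) * (M u v * (\<Prod>i\<in>S. M i (?t (r i)))))"
      unfolding F_def using assms(1,3) by (intro sum.cong refl) (simp add: permutes_not_in)
    finally show ?thesis
      unfolding F_def .
  qed
  \<comment> \<open>What survives exchanges \<open>u\<close> and \<open>v\<close> and permutes
    \<open>S\<close>; the exchange costs one sign.\<close>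
  also have "\<dots> = (\<Sum>r | r permutes S. - (M u v * (of_int (sign r) * (\<Prod>i\<in>S. M i (r i)))))"
  proof (rule sum.cong[OF refl], clarify)
    fix r assume r: "r permutes S"
    have "?t (r i) = r i" if "i \<in> S" for i
      using permutes_in_image[OF r, of i] that assms(2,3) by (metis transpose_apply_other)
    then have "(\<Prod>i\<in>S. M i (?t (r i))) = (\<Prod>i\<in>S. M i (r i))"
      by (intro prod.cong) auto
    moreover have "sign (?t \<circ> r) = - sign r"
      using sign_compose[OF permutation_swap_id[of v u] permutes_imp_permutation[OF assms(1) r]] assms(4)
      by (simp add: sign_swap_id)
    ultimately show "of_int (sign (?t \<circ> r)) * (M u v * (\<Prod>i\<in>S. M i (?t (r i)))) =
        - (M u v * (of_int (sign r) * (\<Prod>i\<in>S. M i (r i))))"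
      by (simp add: mult_ac)
  qed
  also have "\<dots> = - M u v * set_det S M"
    by (simp add: set_det_def sum_negf sum_distrib_left)
  finally have *: "(\<Sum>q | q permutes insert u S. of_int (sign (?t \<circ> q)) *
      (\<Prod>i\<in>insert u S. M i (?t (q i)))) = - M u v * set_det S M" .
  have "set_det (insert v (insert u S)) M = M v v * set_det (insert u S) M +
      M v u * (\<Sum>q | q permutes insert u S. of_int (sign (?t \<circ> q)) * (\<Prod>i\<in>insert u S. M i (?t (q i))))"
    using assms by (subst set_det_insert) (auto simp: set_det_def)
  then show ?thesis
    unfolding * by (simp add: mult_ac)
qed

section \<open>The characteristic polynomial of a starlike tree\<close>

definition adj_entry :: "('v \<Rightarrow> 'v \<Rightarrow> bool) \<Rightarrow> 'v \<Rightarrow> 'v \<Rightarrow> int poly" where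
  "adj_entry E u v = (if u = v then \<X> else 0) - (if E u v then 1 else 0)"

lemma adj_matrix_carrier:
  "adj_matrix G \<in> carrier_mat (length (vertex_enum G)) (length (vertex_enum G))"
  by (simp add: adj_matrix_def Let_def)

lemma vertex_enum:
  assumes "finite (verts G)"
  shows "distinct (vertex_enum G)" "set (vertex_enum G) = verts G"
proof -
  have "\<exists>vs. distinct vs \<and> set vs = verts G"
    using finite_distinct_list[OF assms] by blast
  then have "distinct (vertex_enum G) \<and> set (vertex_enum G) = verts G"
    unfolding vertex_enum_def by (rule someI_ex)
  then show "distinct (vertex_enum G)" "set (vertex_enum G) = verts G"
    by auto
qed

lemma graph_char_poly_eq_set_det:
  assumes "finite (verts G)"
  shows "graph_char_poly G = set_det (verts G) (adj_entry (\<lambda>u v. u \<rightarrow>\<^bsub>G\<^esub> v))"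
proof -
  let ?vs = "vertex_enum G" and ?n = "length (vertex_enum G)"
  note vs = vertex_enum[OF assms]
  have "bij_betw ((!) ?vs) {0..<?n} (verts G)"
    using bij_betw_nth[OF vs(1), of "{0..<?n}" "verts G"] vs(2) by (simp add: lessThan_atLeast0)
  then have "set_det (verts G) (adj_entry (\<lambda>u v. u \<rightarrow>\<^bsub>G\<^esub> v)) =
      set_det {0..<?n} (\<lambda>i j. adj_entry (\<lambda>u v. u \<rightarrow>\<^bsub>G\<^esub> v) (?vs ! i) (?vs ! j))"
    by (intro set_det_reindex) simp_all
  also have "\<dots> = set_det {0..<?n} (\<lambda>i j. char_poly_matrix (adj_matrix G) $$ (i, j))"
  proof (rule set_det_cong)
    fix i j assume "i \<in> {0..<?n}" "j \<in> {0..<?n}"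
    then show "adj_entry (\<lambda>u v. u \<rightarrow>\<^bsub>G\<^esub> v) (?vs ! i) (?vs ! j) = char_poly_matrix (adj_matrix G) $$ (i, j)"
      using vs(1) by (auto simp: adj_entry_def char_poly_matrix_def adj_matrix_def Let_def nth_eq_iff_index_eq one_pCons)
  qed
  also have "\<dots> = graph_char_poly G"
    unfolding graph_char_poly_def char_poly_def
    by (rule det_eq_set_det[symmetric]) (simp add: adj_matrix_carrier)
  finally show ?thesis ..
qed

text \<open>Eigenvalues are taken from the real adjacency matrix and the characteristic polynomial
  from the integer one; the embedding of the integers commutes with
  \<open>char_poly\<close>.\<close>

lemma graph_eigenvalue_iff: "graph_eigenvalue G x \<longleftrightarrow> poly (map_poly real_of_int (graph_char_poly G)) x = 0"
proof -
  have "adj_matrix G = map_mat real_of_int (adj_matrix G)"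
    by (rule eq_matI) (auto simp: adj_matrix_def Let_def)
  then have "char_poly (adj_matrix G) = map_poly real_of_int (graph_char_poly G)"
    using of_int_hom.char_poly_hom[OF adj_matrix_carrier[of G], where ?'a = real]
    by (simp add: graph_char_poly_def)
  then show ?thesis
    unfolding graph_eigenvalue_def eigenvalue_root_char_poly[OF adj_matrix_carrier] by simp
qed

lemma graph_char_poly_iso:
  assumes "digraph_iso G H" "finite (verts G)"
  shows "graph_char_poly G = graph_char_poly H"
proof -
  obtain f where f: "pre_digraph.digraph_isomorphism G f" and H: "H = app_iso f G"
    using assms(1) by (auto simp: digraph_iso_def)
  interpret wf_digraph G
    using f by (simp add: pre_digraph.digraph_isomorphism_def)
  have inj: "inj_on (iso_verts f) (verts G)"
    using f by (rule digraph_isomorphism_inj_on_verts)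
  then have "bij_betw (iso_verts f) (verts G) (verts H)"
    by (simp add: H bij_betw_def)
  then have "set_det (verts H) (adj_entry (\<lambda>u v. u \<rightarrow>\<^bsub>H\<^esub> v)) =
      set_det (verts G) (\<lambda>u v. adj_entry (\<lambda>u v. u \<rightarrow>\<^bsub>H\<^esub> v) (iso_verts f u) (iso_verts f v))"
    using assms(2) by (rule set_det_reindex)
  also have "\<dots> = set_det (verts G) (adj_entry (\<lambda>u v. u \<rightarrow>\<^bsub>G\<^esub> v))"
  proof (rule set_det_cong)
    fix u v assume uv: "u \<in> verts G" "v \<in> verts G"
    have "iso_verts f u \<rightarrow>\<^bsub>H\<^esub> iso_verts f v \<longleftrightarrow> u \<rightarrow>\<^bsub>G\<^esub> v"
      using uv f inj unfolding H arcs_ends_app_iso_eq[OF f]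
      by (auto dest: adj_in_verts inj_onD)
    then show "adj_entry (\<lambda>u v. u \<rightarrow>\<^bsub>H\<^esub> v) (iso_verts f u) (iso_verts f v) = adj_entry (\<lambda>u v. u \<rightarrow>\<^bsub>G\<^esub> v) u v"
      using uv f by (simp add: adj_entry_def)
  qed
  finally show ?thesis
    using assms(2) by (simp add: graph_char_poly_eq_set_det H)
qed

text \<open>The adjacency relation of the starlike tree with infinitely many branches of every length.\<close>
fun branch_adj :: "starlike_vertex \<Rightarrow> starlike_vertex \<Rightarrow> bool" where
  "branch_adj Center Center \<longleftrightarrow> False"
| "branch_adj Center (Branch i j l) \<longleftrightarrow> l = 1"
| "branch_adj (Branch i j l) Center \<longleftrightarrow> l = 1"
| "branch_adj (Branch i j l) (Branch i' j' l') \<longleftrightarrow> i = i' \<and> j = j' \<and> (l = Suc l' \<or> l' = Suc l)"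

text \<open>Only the first \<open>n\<close> vertices are taken, and \<open>n\<close> may differ from
  the branch length \<open>fst k\<close>, so that a branch can be built up from the center one
  vertex at a time.\<close>

definition branch :: "nat \<times> nat \<Rightarrow> nat \<Rightarrow> starlike_vertex set" where
  "branch k n = (\<lambda>l. Branch (fst k) (snd k) l) ` {1..n}"

definition branches :: "(nat \<times> nat) list \<Rightarrow> starlike_vertex set" where
  "branches ks = (\<Union>k\<in>set ks. branch k (fst k))"

lemma branch_0 [simp]: "branch k 0 = {}"
  by (simp add: branch_def)

lemma branch_Suc: "branch k (Suc n) = insert (Branch (fst k) (snd k) (Suc n)) (branch k n)"
  by (auto simp: branch_def atLeastAtMostSuc_conv)

lemma branches_simps [simp]:
  "branches [] = {}"
  "branches (k # ks) = branch k (fst k) \<union> branches ks"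
  by (auto simp: branches_def)

lemma finite_branches: "finite (branches ks)"
  by (auto simp: branches_def branch_def)

text \<open>The outermost vertex is pendant, and deleting it reproduces the recursion of
  \<open>path_poly\<close>. The induction is done without and with the center; in the latter case
  the vertex next to the center is pendant at the center itself.\<close>

lemma set_det_branch:
  fixes S :: "starlike_vertex set"
  defines "M \<equiv> adj_entry branch_adj"
  assumes "finite S" "\<And>l. Branch (fst k) (snd k) l \<notin> S" "Center \<notin> S"
  shows "set_det (branch k n \<union> S) M = path_poly n * set_det S M"
    and "set_det (insert Center (branch k n \<union> S)) M =
      path_poly n * set_det (insert Center S) M - (if n = 0 then 0 else path_poly (n - 1) * set_det S M)"
proof -
  let ?B = "\<lambda>l. Branch (fst k) (snd k) l"
  have fin: "finite (branch k n)" for n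
    by (simp add: branch_def)
  have notin: "?B l \<notin> branch k n" if "l > n" for l n
    using that by (auto simp: branch_def)
  have other: "\<not> branch_adj (?B l) v \<and> \<not> branch_adj v (?B l) \<and> v \<noteq> ?B l"
    if "v \<in> S" for v l
    using that assms(3,4) by (cases v) (auto simp: prod_eq_iff)
  have own: "\<not> branch_adj (?B (Suc (Suc n))) v \<and> \<not> branch_adj v (?B (Suc (Suc n))) \<and> v \<noteq> ?B (Suc (Suc n))"
    if "v \<in> branch k n" for v n
    using that by (auto simp: branch_def)
  have M_simps: "M (?B l) (?B l) = \<X>" "M (?B (Suc l)) (?B l) = -1" "M (?B l) (?B (Suc l)) = -1"
    "M (?B (Suc 0)) Center = -1" "M Center (?B (Suc 0)) = -1" for l
    by (simp_all add: M_def adj_entry_def)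
  show "set_det (branch k n \<union> S) M = path_poly n * set_det S M"
  proof (induction n rule: path_poly.induct)
    case 2
    have "set_det (insert (?B 1) S) M = M (?B 1) (?B 1) * set_det S M"
      using assms other by (intro set_det_isolated) (auto simp: M_def adj_entry_def)
    then show ?case
      by (simp add: branch_Suc M_simps)
  next
    case (3 n)
    let ?v = "?B (Suc (Suc n))" and ?u = "?B (Suc n)"
    have "set_det (insert ?v (insert ?u (branch k n \<union> S))) M =
        M ?v ?v * set_det (insert ?u (branch k n \<union> S)) M - M ?v ?u * M ?u ?v * set_det (branch k n \<union> S) M"
      using assms(2,3) fin notin other own
      by (intro set_det_pendant) (auto simp: M_def adj_entry_def)
    then show ?case
      using 3 by (simp add: branch_Suc M_simps algebra_simps)
  qed simp
  note no_center = this
  show "set_det (insert Center (branch k n \<union> S)) M =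
      path_poly n * set_det (insert Center S) M - (if n = 0 then 0 else path_poly (n - 1) * set_det S M)"
  proof (induction n rule: path_poly.induct)
    case 2
    have "set_det (insert (?B 1) (insert Center S)) M =
        M (?B 1) (?B 1) * set_det (insert Center S) M - M (?B 1) Center * M Center (?B 1) * set_det S M"
      using assms other by (intro set_det_pendant) (auto simp: M_def adj_entry_def)
    then show ?case
      by (simp add: branch_Suc M_simps insert_commute)
  next
    case (3 n)
    let ?v = "?B (Suc (Suc n))" and ?u = "?B (Suc n)" and ?S = "insert Center (branch k n \<union> S)"
    have "set_det (insert ?v (insert ?u ?S)) M =
        M ?v ?v * set_det (insert ?u ?S) M - M ?v ?u * M ?u ?v * set_det ?S M"
      using assms(2,3) fin notin other own
      by (intro set_det_pendant) (auto simp: M_def adj_entry_def)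
    then have eq: "set_det (insert Center (branch k (Suc (Suc n)) \<union> S)) M =
        \<X> * set_det (insert Center (branch k (Suc n) \<union> S)) M - set_det ?S M"
      by (simp add: branch_Suc M_simps insert_commute)
    \<comment> \<open>For \<open>n = 0\<close> the absent term stands for a path polynomial of index
      -1, which is 0 in the recursion, whereas \<open>path_poly (0 - 1)\<close> would be 1; hence
      the split.\<close>
    show ?case
      unfolding eq 3
      by (cases n) (simp_all add: algebra_simps del: mult_pCons_left mult_pCons_right)
  qed simp
qed

lemma set_det_branches:
  assumes "distinct ks" "\<forall>k\<in>set ks. fst k \<ge> 1"
  shows "set_det (branches ks) (adj_entry branch_adj) = paths_poly (map fst ks) \<and>
    set_det (insert Center (branches ks)) (adj_entry branch_adj) = starlike_poly (map fst ks)"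
  using assms
proof (induction ks)
  case Nil
  have "set_det (insert Center {}) (adj_entry branch_adj) = \<X>"
    by (subst set_det_isolated) (auto simp: adj_entry_def)
  then show ?case
    by simp
next
  case (Cons k ks)
  have "Branch (fst k) (snd k) l \<notin> branches ks" "Center \<notin> branches ks" for l
    using Cons.prems by (auto simp: branches_def branch_def prod_eq_iff)
  note * = set_det_branch[OF finite_branches this, of "fst k"]
  show ?case
    using Cons * by auto
qed

definition branch_labels :: "nat list \<Rightarrow> (nat \<times> nat) list" where
  "branch_labels ns = concat (map (\<lambda>i. map (Pair i) [0..<ns ! (i - 1)]) [1..<Suc (length ns)])"

definition branch_lengths :: "nat list \<Rightarrow> nat list" where
  "branch_lengths ns = concat (map (\<lambda>i. replicate (ns ! (i - 1)) i) [1..<Suc (length ns)])"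

lemma set_branch_labels: "set (branch_labels ns) = {(i, j). 1 \<le> i \<and> i \<le> length ns \<and> j < ns ! (i - 1)}"
  by (auto simp: branch_labels_def)

lemma distinct_branch_labels: "distinct (branch_labels ns)"
proof -
  have "distinct (concat (map (\<lambda>i. map (Pair i) [0..<f i]) is))" if "distinct is" for f :: "nat \<Rightarrow> nat" and "is" :: "nat list"
    using that by (induction "is") (auto simp: distinct_map inj_on_def)
  then show ?thesis
    by (simp add: branch_labels_def)
qed

lemma map_fst_branch_labels: "map fst (branch_labels ns) = branch_lengths ns"
  by (simp add: branch_labels_def branch_lengths_def map_concat o_def map_replicate_const)

lemma branch_lengths_ge_1: "\<forall>b\<in>set (branch_lengths ns). b \<ge> 1"
  by (auto simp: branch_lengths_def)

lemma pverts_starlike: "pverts (starlike ns) = insert Center (branches (branch_labels ns))"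
  by (auto simp: starlike_def branches_def branch_def set_branch_labels image_iff)

lemma parcs_starlike:
  assumes "u \<in> pverts (starlike ns)" "v \<in> pverts (starlike ns)"
  shows "(u, v) \<in> parcs (starlike ns) \<longleftrightarrow> branch_adj u v"
  using assms by (cases u; cases v) (auto simp: starlike_def starlike_edges_def)

lemma finite_verts_starlike: "finite (pverts (starlike ns))"
  by (simp add: pverts_starlike finite_branches)

lemma graph_char_poly_starlike:
  "graph_char_poly (with_proj (starlike ns)) = starlike_poly (branch_lengths ns)"
proof -
  have "graph_char_poly (with_proj (starlike ns)) =
      set_det (pverts (starlike ns)) (adj_entry (\<lambda>u v. u \<rightarrow>\<^bsub>with_proj (starlike ns)\<^esub> v))"
    using graph_char_poly_eq_set_det[of "with_proj (starlike ns)"] finite_verts_starlike by simp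
  also have "\<dots> = set_det (pverts (starlike ns)) (adj_entry branch_adj)"
    by (intro set_det_cong) (simp add: adj_entry_def parcs_starlike)
  also have "\<dots> = starlike_poly (branch_lengths ns)"
    using set_det_branches[OF distinct_branch_labels, of ns]
    by (auto simp: pverts_starlike map_fst_branch_labels set_branch_labels)
  finally show ?thesis .
qed

section \<open>Structure and index of starlike trees\<close>

lemma count_list_concat_replicate:
  "distinct is \<Longrightarrow>
     count_list (concat (map (\<lambda>i. replicate (f i) i) is)) i = (if i \<in> set is then f i else 0)"
proof (induction "is")
  case (Cons k "is")
  have "count_list (replicate m k) i = (if i = k then m else 0)" for m
    by (induction m) auto
  then show ?case
    using Cons by auto
qed simp

lemma count_branch_lengths:
  "count_list (branch_lengths ns) i = (if 1 \<le> i \<and> i \<le> length ns then ns ! (i - 1) else 0)"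
  unfolding branch_lengths_def by (subst count_list_concat_replicate) auto

text \<open>An index beyond the list and an entry 0 both mean that there is no such branch. This is
  what permits dropping trailing zeros.\<close>

lemma starlike_cong:
  assumes "\<And>i. count_list (branch_lengths ns) i = count_list (branch_lengths ns') i"
  shows "starlike ns = starlike ns'"
proof -
  have *: "1 \<le> i \<and> i \<le> length ns \<and> j < ns ! (i - 1) \<and> P \<longleftrightarrow> j < count_list (branch_lengths ns) i \<and> P"
    for ns i j P
    by (auto simp: count_branch_lengths)
  have **: "1 \<le> i \<and> i \<le> length ns \<and> j < ns ! (i - 1) \<longleftrightarrow> j < count_list (branch_lengths ns) i"
    for ns i j
    by (auto simp: count_branch_lengths)
  show ?thesis
    unfolding starlike_def starlike_edges_def * ** assms by simp
qed

lemma finite_verts_is_T: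
  assumes "is_T T ns"
  shows "finite (verts T)"
proof -
  obtain f where f: "pre_digraph.digraph_isomorphism T f" and eq: "with_proj (starlike ns) = app_iso f T"
    using assms by (auto simp: is_T_def digraph_iso_def)
  have "iso_verts f ` verts T = pverts (starlike ns)"
    using eq by (metis verts_app_iso with_proj_simps(1))
  then show ?thesis
    using finite_verts_starlike pre_digraph.digraph_isomorphism_inj_on_verts[OF f]
    by (metis finite_imageD)
qed

lemma graph_char_poly_is_T:
  assumes "is_T T ns"
  shows "graph_char_poly T = starlike_poly (branch_lengths ns)"
  using graph_char_poly_iso[OF _ finite_verts_is_T[OF assms]] assms graph_char_poly_starlike
  unfolding is_T_def by metis

lemma card_branch_adj_Branch:
  "card {v \<in> pverts (starlike ns). branch_adj (Branch i j l) v} \<le> 2"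
proof -
  have "{v \<in> pverts (starlike ns). branch_adj (Branch i j l) v} \<subseteq>
      {Branch i j (Suc l), if l = 1 then Center else Branch i j (l - 1)}"
  proof
    fix v assume "v \<in> {v \<in> pverts (starlike ns). branch_adj (Branch i j l) v}"
    then show "v \<in> {Branch i j (Suc l), if l = 1 then Center else Branch i j (l - 1)}"
      by (cases v) (auto simp: starlike_def split: if_splits)
  qed
  then have "card {v \<in> pverts (starlike ns). branch_adj (Branch i j l) v} \<le>
      card {Branch i j (Suc l), if l = 1 then Center else Branch i j (l - 1)}"
    by (intro card_mono) auto
  also have "\<dots> \<le> 2"
    by (simp add: card_insert_if)
  finally show ?thesis .
qed

lemma card_branch_adj_Center:
  "card {v \<in> pverts (starlike ns). branch_adj Center v} \<le> length (branch_lengths ns)"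
proof -
  have "{v \<in> pverts (starlike ns). branch_adj Center v} \<subseteq>
      (\<lambda>k. Branch (fst k) (snd k) 1) ` set (branch_labels ns)"
    by (auto simp: pverts_starlike branches_def branch_def)
  then have "card {v \<in> pverts (starlike ns). branch_adj Center v} \<le> card (set (branch_labels ns))"
    by (meson card_image_le card_mono finite_imageI finite_set le_trans)
  also have "\<dots> \<le> length (branch_lengths ns)"
    using card_length map_fst_branch_labels by (metis length_map)
  finally show ?thesis .
qed

text \<open>The middle vertex of the claw has three neighbors, but a vertex on a branch has at most
  two. It is therefore mapped to \<open>Center\<close>, whose degree is bounded by the number of
  branches.\<close>

lemma induced_K13_branches:
  assumes "is_T T ns" "has_proper_induced_K13 T"
  shows "length (branch_lengths ns) \<ge> 3"
proof -
  obtain f where f: "pre_digraph.digraph_isomorphism T f" and eq: "with_proj (starlike ns) = app_iso f T"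
    using assms by (auto simp: is_T_def digraph_iso_def)
  interpret wf_digraph T
    using f by (simp add: pre_digraph.digraph_isomorphism_def)
  obtain H U V where H: "induced_subgraph H T" "arcs_ends H = U \<times> V \<union> V \<times> U"
    and UV: "card U = 1" "card V = 3"
    using assms(2) unfolding has_proper_induced_K13_def complete_bipartite_digraph_def by blast
  obtain c where c: "U = {c}"
    using UV(1) by (meson card_1_singletonE)
  have arc: "c \<rightarrow>\<^bsub>T\<^esub> v" if "v \<in> V" for v
    using arcs_ends_mono[OF induced_imp_subgraph[OF H(1)]] H(2) c that by auto
  have "arcs_ends (with_proj (starlike ns)) = (\<lambda>(u, v). (iso_verts f u, iso_verts f v)) ` arcs_ends T"
    unfolding eq by (rule arcs_ends_app_iso_eq[OF f])
  then have arc': "(iso_verts f c, iso_verts f v) \<in> parcs (starlike ns)" if "v \<in> V" for v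
    using arc[OF that] by (auto intro: rev_image_eqI)
  have verts: "pverts (starlike ns) = iso_verts f ` verts T"
    using eq by (metis verts_app_iso with_proj_simps(1))
  obtain v where "v \<in> V"
    using UV(2) by fastforce
  then have V: "V \<subseteq> verts T" "c \<in> verts T"
    using arc adj_in_verts by blast+
  let ?N = "{v \<in> pverts (starlike ns). branch_adj (iso_verts f c) v}"
  have "iso_verts f ` V \<subseteq> ?N"
    using arc' V verts parcs_starlike by blast
  moreover have "card (iso_verts f ` V) = 3"
    using UV(2) V(1) digraph_isomorphism_inj_on_verts[OF f] by (metis card_image inj_on_subset)
  ultimately have "card ?N \<ge> 3"
    using finite_verts_starlike[of ns] card_mono[of ?N "iso_verts f ` V"] by simp
  then show ?thesis
    using card_branch_adj_Branch[of ns] card_branch_adj_Center[of ns]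
    by (cases "iso_verts f c") (fastforce intro: le_trans)+
qed

lemma finite_graph_eigenvalues:
  assumes "graph_char_poly G \<noteq> 0"
  shows "finite {x. graph_eigenvalue G x}"
  using assms by (simp add: graph_eigenvalue_iff poly_roots_finite)

lemma graph_eigenvalue_le_lambda1:
  assumes "graph_char_poly G \<noteq> 0" "graph_eigenvalue G x"
  shows "x \<le> lambda1 G"
  using finite_graph_eigenvalues[OF assms(1)] assms(2) by (simp add: lambda1_def)

text \<open>
  The hypothesis \<open>(b + 4)\<^sup>2 \<le> 4a\<^sup>2\<close> says that the product of both quadratic factors is not positive
  at \<open>2\<close>, so its largest root is at least \<open>2\<close> and dominates the roots of the other factors.
\<close>
lemma lambda1_quad:
  assumes "graph_char_poly G = L * quad a b * quad' a b" "graph_char_poly G \<noteq> 0"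
    and "admissible a b" "(b + 4)\<^sup>2 \<le> 4 * a\<^sup>2"
    and "\<And>x. poly (map_poly real_of_int L) x = 0 \<Longrightarrow> x \<le> 2"
  shows "poly (map_poly real_of_int (quad a b)) (lambda1 G) = 0"
proof -
  define m n where "m = (real_of_int a + sqrt (a\<^sup>2 - 4 * b)) / 2" and "n = (real_of_int a - sqrt (a\<^sup>2 - 4 * b)) / 2"
  have "real_of_int (a\<^sup>2 - 4 * b) > 0" "real_of_int a > 0"
    using assms(3) unfolding admissible_def by (simp_all only: of_int_0_less_iff)
  then have sum: "m + n = a" and prod: "m * n = b" and mn: "\<bar>n\<bar> \<le> m"
    by (auto simp: m_def n_def field_simps power2_eq_square abs_if)
  have q: "poly (map_poly real_of_int (quad a b)) x = (x - m) * (x - n)" for x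
    by (simp add: sum[symmetric] prod[symmetric] algebra_simps power2_eq_square of_int_poly_hom.hom_add
        of_int_poly_hom.hom_minus of_int_poly_hom.hom_mult)
  have q': "poly (map_poly real_of_int (quad' a b)) x = (x + m) * (x + n)" for x
    by (simp add: sum[symmetric] prod[symmetric] algebra_simps power2_eq_square of_int_poly_hom.hom_add
        of_int_poly_hom.hom_minus of_int_poly_hom.hom_mult)
  have "m \<ge> 2"
  proof (rule ccontr)
    assume "\<not> m \<ge> 2"
    then have "(2 - m) * (2 - n) * (2 + m) * (2 + n) > 0"
      using mn by (intro mult_pos_pos) auto
    also have "(2 - m) * (2 - n) * (2 + m) * (2 + n) = (m * n + 4)\<^sup>2 - 4 * (m + n)\<^sup>2"
      by (simp add: algebra_simps power2_eq_square)
    also have "\<dots> = real_of_int ((b + 4)\<^sup>2 - 4 * a\<^sup>2)"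
      by (simp add: sum prod)
    also have "\<dots> \<le> real_of_int 0"
      using assms(4) by (simp only: of_int_le_iff)
    finally show False
      by simp
  qed
  have ev: "graph_eigenvalue G x \<longleftrightarrow> poly (map_poly real_of_int L) x = 0 \<or>
      (x - m) * (x - n) = 0 \<or> (x + m) * (x + n) = 0" for x
    unfolding graph_eigenvalue_iff assms(1) of_int_poly_hom.hom_mult poly_mult q q' by auto
  have "lambda1 G = m"
    unfolding lambda1_def
  proof (rule Max_eqI[OF finite_graph_eigenvalues[OF assms(2)]])
    fix x assume "x \<in> {x. graph_eigenvalue G x}"
    then show "x \<le> m"
      using ev[of x] assms(5)[of x] \<open>m \<ge> 2\<close> mn by auto
  qed (simp add: ev)
  then show ?thesis
    by (simp only: q) simp
qed

section \<open>The five special eigenvalues\<close>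

definition golden :: real where
  "golden = (1 + sqrt 5) / 2"

lemma golden_square: "golden * golden = golden + 1"
  by (simp add: golden_def field_simps)

lemma golden_bounds: "golden > 1" "golden < 2" "golden < sqrt 3"
proof -
  have "sqrt 5 > 1" "sqrt 5 < 9 / 4"
    by (rule real_less_rsqrt real_less_lsqrt; simp add: power2_eq_square)+
  moreover have "sqrt 3 > 17 / 10"
    by (rule real_less_rsqrt) (simp add: power2_eq_square)
  ultimately show "golden > 1" "golden < 2" "golden < sqrt 3"
    by (simp_all add: golden_def)
qed

text \<open>The exponent of \<open>p\<close> is even in a nonzero square and odd in \<open>p\<close>
  times a nonzero square.\<close>

lemma prime_times_square_eq_square:
  fixes x y :: int
  assumes "prime p" "x\<^sup>2 = p * y\<^sup>2"
  shows "y = 0"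
proof (rule ccontr)
  assume "y \<noteq> 0"
  then have "x \<noteq> 0"
    using assms by (auto simp: prime_gt_0_int)
  have "2 * multiplicity p x = multiplicity p (x\<^sup>2)"
    using prime_elem_multiplicity_power_distrib[OF prime_imp_prime_elem[OF assms(1)] \<open>x \<noteq> 0\<close>, of 2]
    by simp
  also have "\<dots> = Suc (2 * multiplicity p y)"
    unfolding assms(2) using assms(1) \<open>y \<noteq> 0\<close>
    by (subst prime_elem_multiplicity_mult_distrib)
       (auto simp: prime_elem_multiplicity_power_distrib prime_gt_0_int)
  finally show False
    by presburger
qed

text \<open>As \<open>2 * golden - 1 = sqrt 5\<close>, a relation yields
  \<open>(2x + y)^2 = 5 y^2\<close>.\<close>

lemma golden_independent:
  fixes x y :: int
  assumes "x + y * golden = 0"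
  shows "x = 0" "y = 0"
proof -
  have "real_of_int y * sqrt 5 = - real_of_int (2 * x + y)"
    using assms by (simp add: golden_def field_simps)
  then have "(real_of_int (2 * x + y))\<^sup>2 = (real_of_int y * sqrt 5)\<^sup>2"
    by (metis power2_minus)
  then have "real_of_int ((2 * x + y)\<^sup>2) = real_of_int (5 * y\<^sup>2)"
    by (simp add: power_mult_distrib)
  then have "(2 * x + y)\<^sup>2 = 5 * y\<^sup>2"
    by (simp only: of_int_eq_iff)
  moreover have "prime (5 :: int)"
    by simp
  ultimately show "y = 0"
    using prime_times_square_eq_square by blast
  then show "x = 0"
    using assms by simp
qed

lemma poly_path_poly_small:
  fixes x :: real
  shows "poly (path_poly 0) x = 1" "poly (path_poly (Suc 0)) x = x" "poly (path_poly 2) x = x * x - 1"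
    "poly (path_poly 3) x = x * (x * x - 1) - x"
    "poly (path_poly 4) x = x * (x * (x * x - 1) - x) - (x * x - 1)"
    "poly (path_poly 5) x = x * (x * (x * (x * x - 1) - x) - (x * x - 1)) - (x * (x * x - 1) - x)"
  by (simp_all add: eval_nat_numeral algebra_simps)

text \<open>
  For \<open>d = 2, 3, 4, 5, 6\<close> these are \<open>2 cos (\<pi> / d)\<close>, that is \<open>0\<close>, \<open>1\<close>, \<open>\<surd>2\<close>, the golden ratio and \<open>\<surd>3\<close>.
\<close>
definition special :: "nat \<Rightarrow> real \<Rightarrow> bool" where
  "special d x \<longleftrightarrow> d \<ge> 1 \<and> poly (path_poly (d - 1)) x = 0 \<and> poly (path_poly d) x = -1 \<and>
     (\<forall>i<d - 1. poly (path_poly i) x \<noteq> 0)"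

lemma special_0: "special 2 0"
  by (simp add: special_def poly_path_poly_small)

lemma special_1: "special 3 1"
proof -
  have *: "i < 2 \<longleftrightarrow> i = 0 \<or> i = Suc 0" for i :: nat
    by linarith
  then show ?thesis
    by (auto simp: special_def poly_path_poly_small *)
qed

lemma special_sqrt2: "special 4 (sqrt 2)"
proof -
  have *: "i < 3 \<longleftrightarrow> i = 0 \<or> i = Suc 0 \<or> i = 2" for i :: nat
    by linarith
  then show ?thesis
    by (auto simp: special_def poly_path_poly_small *)
qed

lemma path_poly_golden:
  "poly (path_poly 2) golden = golden" "poly (path_poly 3) golden = 1"
  "poly (path_poly 4) golden = 0" "poly (path_poly 5) golden = -1"
proof -
  note * = poly_path_poly_small[of golden] golden_square
  show 2: "poly (path_poly 2) golden = golden"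
    unfolding * by simp
  have "poly (path_poly 3) golden = golden * poly (path_poly 2) golden - golden"
    by (simp only: *)
  then show 3: "poly (path_poly 3) golden = 1"
    unfolding 2 golden_square by simp
  have "poly (path_poly 4) golden = golden * poly (path_poly 3) golden - poly (path_poly 2) golden"
    by (simp only: *)
  then show 4: "poly (path_poly 4) golden = 0"
    unfolding 3 2 by simp
  have "poly (path_poly 5) golden = golden * poly (path_poly 4) golden - poly (path_poly 3) golden"
    by (simp only: *)
  then show "poly (path_poly 5) golden = -1"
    unfolding 4 3 by simp
qed

lemma special_golden: "special 5 golden"
proof -
  have *: "i < 4 \<longleftrightarrow> i = 0 \<or> i = Suc 0 \<or> i = 2 \<or> i = 3" for i :: nat
    by linarith
  moreover have "golden \<noteq> 0"
    using golden_bounds(1) by linarith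
  ultimately show ?thesis
    by (auto simp: special_def path_poly_golden poly_path_poly_small(1,2) *)
qed

lemma special_sqrt3: "special 6 (sqrt 3)"
proof -
  have *: "i < 5 \<longleftrightarrow> i = 0 \<or> i = Suc 0 \<or> i = 2 \<or> i = 3 \<or> i = 4" for i :: nat
    by linarith
  moreover have "poly (path_poly 6) (sqrt 3) = -1"
    by (simp add: eval_nat_numeral algebra_simps)
  ultimately show ?thesis
    by (auto simp: special_def poly_path_poly_small *)
qed

text \<open>For \<open>special d x\<close> this counts the branches whose path has \<open>x\<close>
  as an eigenvalue, that is, the poles at \<open>x\<close>.\<close>

definition hits :: "nat \<Rightarrow> nat list \<Rightarrow> nat" where
  "hits d bs = length (filter (\<lambda>b. d dvd Suc b) bs)"

lemma root_count_special:
  assumes "special d x"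
  shows "root_count x bs = hits d bs"
proof -
  have "poly (path_poly b) x = 0 \<longleftrightarrow> d dvd Suc b" for b
    using poly_path_poly_eq_0_iff[of "d - 1" x b] assms by (auto simp: special_def)
  then show ?thesis
    by (simp add: root_count_def hits_def)
qed

text \<open>By antiperiodicity numerator and denominator change sign together under a shift by
  \<open>d\<close>. If \<open>d\<close> divides \<open>b\<close>, the numerator vanishes. If
  \<open>b mod d = d - 1\<close>, both denominators vanish and both quotients are 0 by
  convention.\<close>

lemma path_poly_ratio_mod:
  assumes "special d x" "b \<ge> 1"
  shows "poly (path_poly (b - 1)) x / poly (path_poly b) x =
    (if b mod d = 0 then 0 else poly (path_poly (b mod d - 1)) x / poly (path_poly (b mod d)) x)"
proof -
  have d: "poly (path_poly (d - 1)) x = 0" "poly (path_poly (Suc (d - 1))) x = -1" "Suc (d - 1) = d"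
    using assms(1) by (auto simp: special_def)
  note step = poly_path_poly_antiperiodic[OF d(1,2), unfolded d(3)]
  have anti: "poly (path_poly (r + k * d)) x = (-1) ^ k * poly (path_poly r) x" for r k
  proof (induction k)
    case (Suc k)
    then show ?case
      using step[of "r + k * d"] by (simp add: algebra_simps)
  qed simp
  show ?thesis
  proof (cases "b mod d = 0")
    case True
    then obtain k where "b = d * k"
      by auto
    moreover from this have "k \<ge> 1"
      using assms(2) by (cases k) auto
    ultimately have "b - 1 = (d - 1) + (k - 1) * d"
      using d(3) by (cases k) (auto simp: algebra_simps)
    then show ?thesis
      using anti[of "d - 1" "k - 1"] d(1) True by simp
  next
    case False
    then have "b = b mod d + (b div d) * d" "b - 1 = (b mod d - 1) + (b div d) * d"
      by simp_all
    then show ?thesis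
      using anti[of "b mod d" "b div d"] anti[of "b mod d - 1" "b div d"] False by simp
  qed
qed

lemma path_poly_ratio_0: "b \<ge> 1 \<Longrightarrow> poly (path_poly (b - 1)) 0 / poly (path_poly b) (0::real) = 0"
  using path_poly_ratio_mod[OF special_0, of b] by (auto simp: mod2_eq_if split: if_splits)

lemma path_poly_ratio_1:
  assumes "b \<ge> 1"
  shows "poly (path_poly (b - 1)) 1 / poly (path_poly b) (1::real) = of_int (of_bool (b mod 3 = 1))"
proof -
  have "b mod 3 \<in> {0, 1, 2}"
    by auto
  then show ?thesis
    using path_poly_ratio_mod[OF special_1 assms] by (auto simp: poly_path_poly_small)
qed

text \<open>The weights are the numerators of the ratios over the denominators \<open>sqrt 2\<close>
  and, for \<open>sqrt3_weight\<close>, \<open>2 * sqrt 3\<close>. The ratios thus add up to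
  \<open>sqrt 2\<close> or \<open>sqrt 3\<close> exactly if the weights add up to 2 or 6.\<close>

definition sqrt2_weight :: "nat \<Rightarrow> int" where
  "sqrt2_weight b = (if b mod 4 = 1 then 1 else if b mod 4 = 2 then 2 else 0)"

definition sqrt3_weight :: "nat \<Rightarrow> int" where
  "sqrt3_weight b = (if b mod 6 = 1 then 2 else if b mod 6 = 2 then 3 else if b mod 6 = 3 then 4
     else if b mod 6 = 4 then 6 else 0)"

lemma path_poly_ratio_sqrt2:
  assumes "b \<ge> 1"
  shows "poly (path_poly (b - 1)) (sqrt 2) / poly (path_poly b) (sqrt 2) = of_int (sqrt2_weight b) / sqrt 2"
proof -
  have "b mod 4 \<in> {0, 1, 2, 3}"
    by auto
  then show ?thesis
    using path_poly_ratio_mod[OF special_sqrt2 assms]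
    by (auto simp: poly_path_poly_small sqrt2_weight_def field_simps)
qed

lemma path_poly_ratio_sqrt3:
  assumes "b \<ge> 1"
  shows "poly (path_poly (b - 1)) (sqrt 3) / poly (path_poly b) (sqrt 3) = of_int (sqrt3_weight b) / (2 * sqrt 3)"
proof -
  have "b mod 6 \<in> {0, 1, 2, 3, 4, 5}"
    by auto
  then show ?thesis
    using path_poly_ratio_mod[OF special_sqrt3 assms]
    by (auto simp: poly_path_poly_small sqrt3_weight_def field_simps)
qed

text \<open>Writing g for \<open>golden\<close>, the path polynomials run through 1, g, g, 1, 0
  there, so the ratios are \<open>1/g = g - 1\<close>, 1 and g. Splitting them into integer part and
  coefficient of g prepares the use of \<open>golden_independent\<close>.\<close>

lemma path_poly_ratio_golden:
  assumes "b \<ge> 1"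
  shows "poly (path_poly (b - 1)) golden / poly (path_poly b) golden =
    of_int (of_bool (b mod 5 = 2) - of_bool (b mod 5 = 1)) +
    of_int (of_bool (b mod 5 = 1) + of_bool (b mod 5 = 3)) * golden"
proof -
  have "1 / golden = golden - 1"
    using golden_square golden_bounds(1) by (simp add: nonzero_divide_eq_eq left_diff_distrib)
  moreover have "b mod 5 \<in> {0, 1, 2, 3, 4}"
    by auto
  ultimately show ?thesis
    using path_poly_ratio_mod[OF special_golden assms] path_poly_golden poly_path_poly_small(1,2)[of golden] golden_bounds(1) by auto
qed

section \<open>The multiplicity equations\<close>

lemma order_starlike_poly_special:
  assumes "special d e" "\<forall>b\<in>set bs. b \<ge> 1"
  shows "hits d bs \<ge> 1 \<Longrightarrow> order e (starlike_poly bs) = hits d bs - 1"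
    and "hits d bs = 0 \<Longrightarrow> order e (starlike_poly bs) =
      (if (\<Sum>b\<leftarrow>bs. poly (path_poly (b - 1)) e / poly (path_poly b) e) = e then 1 else 0)"
proof -
  note count = root_count_special[OF assms(1), of bs]
  show "hits d bs \<ge> 1 \<Longrightarrow> order e (starlike_poly bs) = hits d bs - 1"
    using order_starlike_poly[OF assms(2)] by (simp add: count)
  assume "hits d bs = 0"
  then have 0: "root_count e bs = 0"
    by (simp add: count)
  show "order e (starlike_poly bs) =
      (if (\<Sum>b\<leftarrow>bs. poly (path_poly (b - 1)) e / poly (path_poly b) e) = e then 1 else 0)"
    using poly_paths_poly_nonzero[OF 0]
    by (auto simp: order_starlike_poly_le_1[OF assms(2) 0] poly_starlike_poly[OF 0])
qed

lemma sum_list_of_int: "(\<Sum>b\<leftarrow>bs. real_of_int (g b)) = real_of_int (\<Sum>b\<leftarrow>bs. g b)"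
  by (induction bs) simp_all

lemma order_at_0:
  assumes "\<forall>b\<in>set bs. b \<ge> 1"
  shows "order 0 (starlike_poly bs :: real poly) = (if hits 2 bs = 0 then 1 else hits 2 bs - 1)"
proof -
  have "(\<Sum>b\<leftarrow>bs. poly (path_poly (b - 1)) 0 / poly (path_poly b) (0::real)) = (\<Sum>b\<leftarrow>bs. 0)"
    using assms path_poly_ratio_0 by (intro arg_cong[where f = sum_list] map_cong refl) blast
  then show ?thesis
    using order_starlike_poly_special[OF special_0 assms] by auto
qed

lemma order_at_1:
  assumes "\<forall>b\<in>set bs. b \<ge> 1"
  shows "order 1 (starlike_poly bs :: real poly) =
    (if hits 3 bs = 0 then of_bool ((\<Sum>b\<leftarrow>bs. of_bool (b mod 3 = 1)) = (1::int)) else hits 3 bs - 1)"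
proof -
  have "(\<Sum>b\<leftarrow>bs. poly (path_poly (b - 1)) 1 / poly (path_poly b) (1::real)) =
      real_of_int (\<Sum>b\<leftarrow>bs. of_bool (b mod 3 = 1))"
    unfolding sum_list_of_int[symmetric]
    using assms path_poly_ratio_1 by (intro arg_cong[where f = sum_list] map_cong refl) blast
  then show ?thesis
    using order_starlike_poly_special[OF special_1 assms] by auto
qed

lemma order_at_sqrt2:
  assumes "\<forall>b\<in>set bs. b \<ge> 1"
  shows "order (sqrt 2) (starlike_poly bs) =
    (if hits 4 bs = 0 then of_bool ((\<Sum>b\<leftarrow>bs. sqrt2_weight b) = 2) else hits 4 bs - 1)"
proof -
  have "(\<Sum>b\<leftarrow>bs. poly (path_poly (b - 1)) (sqrt 2) / poly (path_poly b) (sqrt 2)) =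
      (\<Sum>b\<leftarrow>bs. of_int (sqrt2_weight b) * (1 / sqrt 2))"
    using assms path_poly_ratio_sqrt2 by (intro arg_cong[where f = sum_list] map_cong refl) simp
  also have "\<dots> = real_of_int (\<Sum>b\<leftarrow>bs. sqrt2_weight b) / sqrt 2"
    unfolding sum_list_mult_const sum_list_of_int by simp
  finally have *: "(\<Sum>b\<leftarrow>bs. poly (path_poly (b - 1)) (sqrt 2) / poly (path_poly b) (sqrt 2)) = sqrt 2 \<longleftrightarrow>
      real_of_int (\<Sum>b\<leftarrow>bs. sqrt2_weight b) = 2"
    by (simp add: divide_eq_eq)
  show ?thesis
    using order_starlike_poly_special[OF special_sqrt2 assms] unfolding * by auto
qed

lemma order_at_sqrt3:
  assumes "\<forall>b\<in>set bs. b \<ge> 1"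
  shows "order (sqrt 3) (starlike_poly bs) =
    (if hits 6 bs = 0 then of_bool ((\<Sum>b\<leftarrow>bs. sqrt3_weight b) = 6) else hits 6 bs - 1)"
proof -
  have "(\<Sum>b\<leftarrow>bs. poly (path_poly (b - 1)) (sqrt 3) / poly (path_poly b) (sqrt 3)) =
      (\<Sum>b\<leftarrow>bs. of_int (sqrt3_weight b) * (1 / (2 * sqrt 3)))"
    using assms path_poly_ratio_sqrt3 by (intro arg_cong[where f = sum_list] map_cong refl) simp
  also have "\<dots> = real_of_int (\<Sum>b\<leftarrow>bs. sqrt3_weight b) / (2 * sqrt 3)"
    unfolding sum_list_mult_const sum_list_of_int by simp
  finally have *: "(\<Sum>b\<leftarrow>bs. poly (path_poly (b - 1)) (sqrt 3) / poly (path_poly b) (sqrt 3)) = sqrt 3 \<longleftrightarrow>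
      real_of_int (\<Sum>b\<leftarrow>bs. sqrt3_weight b) = 6"
    by (simp add: divide_eq_eq mult.left_commute[of "sqrt 3" 2])
  show ?thesis
    using order_starlike_poly_special[OF special_sqrt3 assms] unfolding * by auto
qed

lemma order_at_golden:
  assumes "\<forall>b\<in>set bs. b \<ge> 1"
  shows "order golden (starlike_poly bs) =
    (if hits 5 bs = 0 then
       of_bool ((\<Sum>b\<leftarrow>bs. of_bool (b mod 5 = 2) - of_bool (b mod 5 = 1)) = (0::int) \<and>
                (\<Sum>b\<leftarrow>bs. of_bool (b mod 5 = 1) + of_bool (b mod 5 = 3)) = (1::int))
     else hits 5 bs - 1)"
proof -
  let ?u = "\<lambda>b::nat. of_bool (b mod 5 = 2) - of_bool (b mod 5 = 1) :: int"
  let ?v = "\<lambda>b::nat. of_bool (b mod 5 = 1) + of_bool (b mod 5 = 3) :: int"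
  have "(\<Sum>b\<leftarrow>bs. poly (path_poly (b - 1)) golden / poly (path_poly b) golden) =
      (\<Sum>b\<leftarrow>bs. of_int (?u b) + of_int (?v b) * golden)"
    using assms path_poly_ratio_golden by (intro arg_cong[where f = sum_list] map_cong refl) blast
  also have "\<dots> = real_of_int (\<Sum>b\<leftarrow>bs. ?u b) + real_of_int (\<Sum>b\<leftarrow>bs. ?v b) * golden"
    unfolding sum_list_addf sum_list_mult_const sum_list_of_int ..
  finally have sum: "(\<Sum>b\<leftarrow>bs. poly (path_poly (b - 1)) golden / poly (path_poly b) golden) =
      real_of_int (\<Sum>b\<leftarrow>bs. ?u b) + real_of_int (\<Sum>b\<leftarrow>bs. ?v b) * golden" .
  have *: "real_of_int u + real_of_int v * golden = golden \<longleftrightarrow> u = 0 \<and> v = 1" for u v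
    using golden_independent[of u "v - 1"] by (auto simp: left_diff_distrib)
  show ?thesis
    using order_starlike_poly_special[OF special_golden assms] unfolding sum * by auto
qed

section \<open>Solving the multiplicity equations\<close>

text \<open>\<open>n\<^sub>i\<close> is the number of branches of length \<open>i\<close>.
  \<open>e1\<close> to \<open>e5\<close> are the exponents of the factors belonging to 0, 1,
  \<open>sqrt 2\<close>, \<open>golden\<close> and \<open>sqrt 3\<close>, each minus the number of
  branches with a pole there. Once the values of the \<open>e\<close>'s are fixed, all constraints
  are linear.\<close>

locale multiplicity_system =
  fixes n1 n2 n3 n4 n5 n6 n7 n8 n9 n10 n12 n13 e1 e2 e3 e4 e5 :: int
  assumes nonneg: "n1 \<ge> 0" "n2 \<ge> 0" "n3 \<ge> 0" "n4 \<ge> 0" "n5 \<ge> 0" "n6 \<ge> 0" "n7 \<ge> 0" "n8 \<ge> 0"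
      "n9 \<ge> 0" "n10 \<ge> 0" "n12 \<ge> 0" "n13 \<ge> 0"
    and e1: "e1 = (if n1 + n3 + n5 + n7 + n9 + n13 = 0 then 1 else -1)"
    and e2: "e2 = (if n2 + n5 + n8 = 0 then of_bool (n1 + n4 + n7 + n10 + n13 = 1) else -1)"
    and e3: "e3 = (if n3 + n7 = 0
               then of_bool (n1 + 2 * n2 + n5 + 2 * n6 + n9 + 2 * n10 + n13 = 2) else -1)"
    and e4: "e4 = (if n4 + n9 = 0
               then of_bool (n1 + n6 = n2 + n7 + n12 \<and> n1 + n6 + n3 + n8 + n13 = 1) else -1)"
    and e5: "e5 = (if n5 = 0
               then of_bool (2 * n1 + 3 * n2 + 4 * n3 + 6 * n4 + 2 * n7 + 3 * n8 + 4 * n9 + 6 * n10 + 2 * n13 = 6)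
               else -1)"
    and total: "n1 + n2 + n3 + n4 + n5 + n6 + n7 + n8 + n9 + n10 + n12 + n13 \<ge> 3"
begin

lemma e1_cases:
  obtains "e1 = 1" "n1 = 0" "n3 = 0" "n5 = 0" "n7 = 0" "n9 = 0" "n13 = 0"
  | "e1 = -1" "n1 + n3 + n5 + n7 + n9 + n13 \<ge> 1"
proof (cases "n1 + n3 + n5 + n7 + n9 + n13 = 0")
  case True
  moreover from this have "n1 = 0" "n3 = 0" "n5 = 0" "n7 = 0" "n9 = 0" "n13 = 0"
    using nonneg by linarith+
  ultimately show thesis
    using that(1) e1 by simp
next
  case False
  then show thesis
    using that(2) e1 nonneg by simp
qed

lemma e2_cases:
  obtains "e2 = 1" "n2 = 0" "n5 = 0" "n8 = 0" "n1 + n4 + n7 + n10 + n13 = 1"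
  | "e2 = 0" "n2 = 0" "n5 = 0" "n8 = 0"
  | "e2 = -1" "n2 + n5 + n8 \<ge> 1"
proof (cases "n2 + n5 + n8 = 0")
  case True
  moreover from this have "n2 = 0" "n5 = 0" "n8 = 0"
    using nonneg by linarith+
  ultimately show thesis
    using that(1,2) e2 by (cases "n1 + n4 + n7 + n10 + n13 = 1") simp_all
next
  case False
  then show thesis
    using that(3) e2 nonneg by simp
qed

lemma e3_cases:
  obtains "e3 = 1" "n3 = 0" "n7 = 0" "n1 + 2 * n2 + n5 + 2 * n6 + n9 + 2 * n10 + n13 = 2"
  | "e3 = 0" "n3 = 0" "n7 = 0"
  | "e3 = -1" "n3 + n7 \<ge> 1"
proof (cases "n3 + n7 = 0")
  case True
  moreover from this have "n3 = 0" "n7 = 0"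
    using nonneg by linarith+
  ultimately show thesis
    using that(1,2) e3 by (cases "n1 + 2 * n2 + n5 + 2 * n6 + n9 + 2 * n10 + n13 = 2") simp_all
next
  case False
  then show thesis
    using that(3) e3 nonneg by simp
qed

lemma e4_cases:
  obtains "e4 = 1" "n4 = 0" "n9 = 0" "n1 + n6 = n2 + n7 + n12" "n1 + n6 + n3 + n8 + n13 = 1"
  | "e4 = 0" "n4 = 0" "n9 = 0"
  | "e4 = -1" "n4 + n9 \<ge> 1"
proof (cases "n4 + n9 = 0")
  case True
  moreover from this have "n4 = 0" "n9 = 0"
    using nonneg by linarith+
  ultimately show thesis
    using that(1,2) e4
    by (cases "n1 + n6 = n2 + n7 + n12 \<and> n1 + n6 + n3 + n8 + n13 = 1") auto
next
  case False
  then show thesis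
    using that(3) e4 nonneg by simp
qed

lemma e5_cases:
  obtains "e5 = 1" "n5 = 0"
    "2 * n1 + 3 * n2 + 4 * n3 + 6 * n4 + 2 * n7 + 3 * n8 + 4 * n9 + 6 * n10 + 2 * n13 = 6"
  | "e5 = 0" "n5 = 0"
  | "e5 = -1" "n5 \<ge> 1"
proof (cases "n5 = 0")
  case True
  then show thesis
    using that(1,2) e5
    by (cases "2 * n1 + 3 * n2 + 4 * n3 + 6 * n4 + 2 * n7 + 3 * n8 + 4 * n9 + 6 * n10 + 2 * n13 = 6") auto
next
  case False
  then show thesis
    using that(3) e5 nonneg by simp
qed

text \<open>The coefficient of \<open>n\<^sub>b\<close> is the degree of \<open>p\<^sub>b\<close>
  minus that of its special factors, and 0 for \<open>b \<le> 5\<close>. On the right, 3 is the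
  degree 4 of the quadratic factors minus the 1 contributed by the center, and the
  \<open>e\<close>'s are weighted by the degrees of their factors.\<close>

lemma large_zero:
  assumes "6 * n6 + 4 * n7 + 6 * n8 + 4 * n9 + 10 * n10 + 12 * n12 + 12 * n13
    = 3 + e1 + 2 * e2 + 2 * e3 + 4 * e4 + 2 * e5"
  shows "n6 = 0 \<and> n7 = 0 \<and> n8 = 0 \<and> n9 = 0 \<and> n10 = 0 \<and> n12 = 0 \<and> n13 = 0"
proof (rule ccontr)
  assume "\<not> ?thesis"
  then have big: "n6 + n7 + n8 + n9 + n10 + n12 + n13 \<ge> 1"
    using nonneg by linarith
  show False
    by (cases rule: e4_cases; cases rule: e1_cases; cases rule: e2_cases; cases rule: e3_cases;
        cases rule: e5_cases; use assms big nonneg total in linarith)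
qed

text \<open>In order, these alternatives become families 5, 4, 3, the exceptional case, family 1 and
  family 2.\<close>

lemma solutions:
  assumes "6 * n6 + 4 * n7 + 6 * n8 + 4 * n9 + 10 * n10 + 12 * n12 + 12 * n13
    = 3 + e1 + 2 * e2 + 2 * e3 + 4 * e4 + 2 * e5"
  obtains "n1 \<ge> 1" "n2 \<ge> 1" "n3 = 0" "n4 = 0" "n5 = 0"
      "e1 = -1" "e2 = -1" "e3 = 0" "e4 = 0" "e5 = 0"
    | "n2 = 0" "n3 \<ge> 1" "n4 = 0" "n5 = 0"
      "e1 = -1" "e2 = 0" "e3 = -1" "e4 = 0" "e5 = 0"
    | "n1 = 2" "n2 = 0" "n3 = 0" "n4 \<ge> 1" "n5 = 0"
      "e1 = -1" "e2 = 0" "e3 = 1" "e4 = -1" "e5 = 0"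
    | "n1 = 0" "n2 = 1" "n3 = 0" "n4 \<ge> 2" "n5 = 0"
      "e1 = 1" "e2 = -1" "e3 = 1" "e4 = -1" "e5 = 0"
    | "n1 = 0" "n2 = 0" "n3 = 1" "n4 = 0" "n5 \<ge> 2"
      "e1 = -1" "e2 = -1" "e3 = -1" "e4 = 1" "e5 = -1"
    | "n1 = 0" "n2 = 0" "n3 = 0" "n4 \<ge> 3" "n5 = 0"
      "e1 = 1" "e2 = 0" "e3 = 0" "e4 = -1" "e5 = 0"
proof -
  have large: "n6 = 0" "n7 = 0" "n8 = 0" "n9 = 0" "n10 = 0" "n12 = 0" "n13 = 0"
    using large_zero[OF assms] by auto
  note sum = assms[unfolded large, simplified]
  note facts = large nonneg(1-5) total sum
  show thesis
    by (cases rule: e4_cases; cases rule: e1_cases; cases rule: e2_cases; cases rule: e3_cases;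
        cases rule: e5_cases; (use facts in linarith | (rule that; use facts in linarith)))
qed

text \<open>Here nothing but special factors occurs, so the constant drops from 3 to -1. The bound
  on \<open>e5\<close> keeps out integral trees such as the claw, where \<open>n1 = 3\<close> and
  \<open>e5 = 1\<close>.\<close>

lemma no_solution_without_quad:
  assumes "6 * n6 + 4 * n7 + 6 * n8 + 4 * n9 + 10 * n10 + 12 * n12 + 12 * n13
    = - 1 + e1 + 2 * e2 + 2 * e3 + 4 * e4 + 2 * e5" "e5 \<le> 0" "n5 \<le> 1"
  shows False
  by (cases rule: e4_cases; cases rule: e1_cases; cases rule: e2_cases; cases rule: e3_cases;
      cases rule: e5_cases; use assms nonneg total in linarith)

end

section \<open>Polynomials of form (II)\<close>

definition special_poly :: "nat \<Rightarrow> nat \<Rightarrow> nat \<Rightarrow> nat \<Rightarrow> nat \<Rightarrow> 'a::comm_ring_1 poly" where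
  "special_poly t1 t2 t3 t4 t5 =
     [:0, 1:] ^ t1 * [:-1, 0, 1:] ^ t2 * [:-2, 0, 1:] ^ t3 * [:1, 0, -3, 0, 1:] ^ t4 * [:-3, 0, 1:] ^ t5"

text \<open>For \<open>s = a^2 - 2b\<close> and \<open>p = b^2\<close> this is the product of the
  two quadratic factors. The numbers of branches determine \<open>s\<close> and \<open>p\<close>
  directly.\<close>

definition biquad :: "'a \<Rightarrow> 'a \<Rightarrow> 'a::comm_ring_1 poly" where
  "biquad s p = [:p, 0, - s, 0, 1:]"

lemma quad_mult_quad': "quad a b * quad' a b = biquad (a\<^sup>2 - 2 * b) (b\<^sup>2)"
  by (simp add: biquad_def power2_eq_square algebra_simps)

lemma form_II_poly_eq:
  "\<X>^t1 * (\<X>^2 - 1)^t2 * (\<X>^2 - 2)^t3 * ((\<X>^2 - \<X> - 1) * (\<X>^2 + \<X> - 1))^t4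
     * (\<X>^2 - 3)^t5 * quad a b * quad' a b = special_poly t1 t2 t3 t4 t5 * biquad (a\<^sup>2 - 2 * b) (b\<^sup>2)"
proof -
  have "\<X>^2 - 1 = [:-1, 0, 1:]" "\<X>^2 - 2 = [:-2, 0, 1:]" "\<X>^2 - 3 = [:-3, 0, 1:]"
    "(\<X>^2 - \<X> - 1) * (\<X>^2 + \<X> - 1) = [:1, 0, -3, 0, 1:]"
    by (simp_all add: power2_eq_square one_pCons numeral_poly)
  then show ?thesis
    by (simp only: special_poly_def mult.assoc quad_mult_quad')
qed

lemma of_int_special_poly:
  "map_poly real_of_int (special_poly t1 t2 t3 t4 t5) = special_poly t1 t2 t3 t4 t5"
  by (simp add: special_poly_def of_int_poly_hom.hom_mult of_int_poly_hom.hom_power)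

lemma of_int_biquad: "map_poly real_of_int (biquad s p) = biquad (of_int s) (of_int p)"
  by (simp add: biquad_def)

lemma poly_biquad_factored:
  fixes a b x :: "'a::comm_ring_1"
  shows "poly (biquad (a\<^sup>2 - 2 * b) (b\<^sup>2)) x = (x * x + b + a * x) * (x * x + b - a * x)"
  by (simp add: biquad_def power2_eq_square algebra_simps)

lemma order_power:
  "p \<noteq> 0 \<Longrightarrow> order x (p ^ n) = n * order x (p :: 'a::idom poly)"
  by (induction n) (simp_all add: order_mult)

lemma order_eq_1:
  fixes p :: "real poly"
  assumes "poly p x = 0" "poly (pderiv p) x \<noteq> 0"
  shows "order x p = 1"
proof -
  have "p \<noteq> 0"
    using assms(2) by auto
  then show ?thesis
    using assms order_pderiv[of p x] order_0I[OF assms(2)] by (simp add: order_root)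
qed

lemma special_poly_nonzero [simp]: "special_poly t1 t2 t3 t4 t5 \<noteq> (0 :: 'a::idom poly)"
  by (simp add: special_poly_def)

lemma degree_special_poly:
  "degree (special_poly t1 t2 t3 t4 t5 :: real poly) = t1 + 2 * t2 + 2 * t3 + 4 * t4 + 2 * t5"
  by (simp add: special_poly_def degree_mult_eq degree_power_eq)

lemma order_special_poly:
  "order x (special_poly t1 t2 t3 t4 t5 :: real poly) =
     t1 * order x [:0, 1:] + t2 * order x [:-1, 0, 1:] + t3 * order x [:-2, 0, 1:] +
     t4 * order x [:1, 0, -3, 0, 1:] + t5 * order x [:-3, 0, 1:]"
  by (simp add: special_poly_def order_mult order_power)

lemma golden_square': "golden * (golden * z) = golden * z + z"
  using golden_square by (metis distrib_right mult.assoc mult_1)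

text \<open>Each of the five numbers is a simple root of its own factor and no root of the others,
  so a single real root per factor recovers the exponent.\<close>

lemma order_special_poly_at:
  "order 0 (special_poly t1 t2 t3 t4 t5 :: real poly) = t1"
  "order 1 (special_poly t1 t2 t3 t4 t5 :: real poly) = t2"
  "order (sqrt 2) (special_poly t1 t2 t3 t4 t5 :: real poly) = t3"
  "order golden (special_poly t1 t2 t3 t4 t5 :: real poly) = t4"
  "order (sqrt 3) (special_poly t1 t2 t3 t4 t5 :: real poly) = t5"
proof -
  have "order 0 [:0, 1::real:] = 1" "order 1 [:-1, 0, 1::real:] = 1"
    "order (sqrt 2) [:-2, 0, 1:] = 1" "order (sqrt 3) [:-3, 0, 1:] = 1"
    by (rule order_eq_1; simp add: pderiv_pCons)+
  moreover have "order golden [:1, 0, -3, 0, 1:] = 1"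
    using golden_bounds(1)
    by (intro order_eq_1) (simp_all add: pderiv_pCons golden_square golden_square' algebra_simps)
  moreover have
    "order 0 [:-1, 0, 1::real:] = 0" "order 0 [:-2, 0, 1::real:] = 0"
    "order 0 [:1, 0, -3, 0, 1::real:] = 0" "order 0 [:-3, 0, 1::real:] = 0"
    "order 1 [:0, 1::real:] = 0" "order 1 [:-2, 0, 1::real:] = 0"
    "order 1 [:1, 0, -3, 0, 1::real:] = 0" "order 1 [:-3, 0, 1::real:] = 0"
    "order (sqrt 2) [:0, 1::real:] = 0" "order (sqrt 2) [:-1, 0, 1::real:] = 0"
    "order (sqrt 2) [:1, 0, -3, 0, 1::real:] = 0" "order (sqrt 2) [:-3, 0, 1::real:] = 0"
    "order (sqrt 3) [:0, 1::real:] = 0" "order (sqrt 3) [:-1, 0, 1::real:] = 0"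
    "order (sqrt 3) [:1, 0, -3, 0, 1::real:] = 0" "order (sqrt 3) [:-2, 0, 1::real:] = 0"
    by (rule order_0I; simp add: algebra_simps)+
  moreover have
    "order golden [:0, 1::real:] = 0" "order golden [:-1, 0, 1::real:] = 0"
    "order golden [:-2, 0, 1::real:] = 0" "order golden [:-3, 0, 1::real:] = 0"
    using golden_bounds by (auto intro!: order_0I simp: golden_square)
  ultimately show
    "order 0 (special_poly t1 t2 t3 t4 t5 :: real poly) = t1"
    "order 1 (special_poly t1 t2 t3 t4 t5 :: real poly) = t2"
    "order (sqrt 2) (special_poly t1 t2 t3 t4 t5 :: real poly) = t3"
    "order golden (special_poly t1 t2 t3 t4 t5 :: real poly) = t4"
    "order (sqrt 3) (special_poly t1 t2 t3 t4 t5 :: real poly) = t5"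
    unfolding order_special_poly by simp_all
qed

text \<open>The first two equalities would turn the discriminant into \<open>a^2\<close> or
  \<open>(b - 1)^2\<close>. The other two contradict the parity of the exponents of 2 and 3.\<close>

lemma admissible_not_root:
  assumes "admissible a b"
  shows "b \<noteq> 0" "(1 + b)\<^sup>2 \<noteq> a\<^sup>2" "(2 + b)\<^sup>2 \<noteq> 2 * a\<^sup>2" "(3 + b)\<^sup>2 \<noteq> 3 * a\<^sup>2"
proof -
  have adm: "a > 0" "\<not> is_square (a\<^sup>2 - 4 * b)"
    using assms by (auto simp: admissible_def)
  show "b \<noteq> 0"
    using adm(2) by auto
  show "(1 + b)\<^sup>2 \<noteq> a\<^sup>2"
  proof
    assume "(1 + b)\<^sup>2 = a\<^sup>2"
    then have "a\<^sup>2 - 4 * b = (b - 1)\<^sup>2"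
      by (simp add: power2_eq_square algebra_simps)
    then show False
      using adm(2) by simp
  qed
  show "(2 + b)\<^sup>2 \<noteq> 2 * a\<^sup>2" "(3 + b)\<^sup>2 \<noteq> 3 * a\<^sup>2"
    using prime_times_square_eq_square[of 2 "2 + b" a] prime_times_square_eq_square[of 3 "3 + b" a] adm(1)
    by auto
qed

text \<open>The value at \<open>x\<close> is \<open>(x^2 + b)^2 - a^2 x^2\<close>, so for
  \<open>x^2\<close> equal to 0, 1, 2, 3 the four inequalities of \<open>admissible_not_root\<close>
  apply. At \<open>golden\<close> both factors are integer combinations of 1 and
  \<open>golden\<close>, and only \<open>a = 1\<close>, \<open>b = -1\<close> makes one
  vanish.\<close>

lemma poly_biquad_special:
  assumes "admissible a b"
  defines "q \<equiv> biquad (real_of_int (a\<^sup>2 - 2 * b)) (real_of_int (b\<^sup>2))"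
  shows "poly q 0 \<noteq> 0" "poly q 1 \<noteq> 0" "poly q (sqrt 2) \<noteq> 0" "poly q (sqrt 3) \<noteq> 0"
    "(a, b) \<noteq> (1, -1) \<Longrightarrow> poly q golden \<noteq> 0"
proof -
  have q: "poly q x = (x * x + b + a * x) * (x * x + b - a * x)" for x :: real
    using poly_biquad_factored[of "real_of_int a" "real_of_int b" x] by (simp add: q_def)
  have diff: "poly q x = (x * x + b)\<^sup>2 - (x * x) * (real_of_int a)\<^sup>2" for x :: real
    using q[of x] by (simp add: power2_eq_square algebra_simps)
  note adm = admissible_not_root[OF assms(1)]
  show "poly q 0 \<noteq> 0"
    using adm(1) by (simp add: q)
  have "real_of_int ((1 + b)\<^sup>2) \<noteq> real_of_int (a\<^sup>2)"
    using adm(2) by (simp only: of_int_eq_iff) simp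
  then show "poly q 1 \<noteq> 0"
    by (simp add: diff)
  have "real_of_int ((2 + b)\<^sup>2) \<noteq> real_of_int (2 * a\<^sup>2)"
    using adm(3) by (simp only: of_int_eq_iff) simp
  then show "poly q (sqrt 2) \<noteq> 0"
    by (simp add: diff)
  have "real_of_int ((3 + b)\<^sup>2) \<noteq> real_of_int (3 * a\<^sup>2)"
    using adm(4) by (simp only: of_int_eq_iff) simp
  then show "poly q (sqrt 3) \<noteq> 0"
    by (simp add: diff)
  assume ne: "(a, b) \<noteq> (1, -1)"
  have "a > 0"
    using assms(1) by (simp add: admissible_def)
  have "golden * golden + b + a * golden = real_of_int (1 + b) + real_of_int (1 + a) * golden"
    "golden * golden + b - a * golden = real_of_int (1 + b) + real_of_int (1 - a) * golden"
    by (simp_all add: golden_square algebra_simps)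
  moreover have "real_of_int (1 + b) + real_of_int (1 + a) * golden \<noteq> 0"
    using golden_independent[of "1 + b" "1 + a"] \<open>a > 0\<close> by force
  moreover have "real_of_int (1 + b) + real_of_int (1 - a) * golden \<noteq> 0"
    using golden_independent[of "1 + b" "1 - a"] ne by force
  ultimately show "poly q golden \<noteq> 0"
    unfolding q by simp
qed

section \<open>The possible branch lengths\<close>

text \<open>This is the total degree of the special factors dividing \<open>p\<^sub>b\<close>; the
  weights 1, 2, 2, 4, 2 are the degrees of the five factors and add up to 11.\<close>

definition special_part :: "nat \<Rightarrow> nat" where
  "special_part b = of_bool (2 dvd Suc b) + 2 * of_bool (3 dvd Suc b) + 2 * of_bool (4 dvd Suc b)
     + 4 * of_bool (5 dvd Suc b) + 2 * of_bool (6 dvd Suc b)"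

lemma special_part_le: "b \<ge> 1 \<Longrightarrow> special_part b \<le> b"
proof (cases "b \<ge> 11")
  case True
  have "special_part b \<le> 11"
    unfolding special_part_def by simp
  then show ?thesis
    using True by simp
next
  case False
  assume "b \<ge> 1"
  show ?thesis
  proof (cases "b \<le> 5")
    case True
    with \<open>b \<ge> 1\<close> have "b = 1 \<or> b = 2 \<or> b = 3 \<or> b = 4 \<or> b = 5"
      by linarith
    then show ?thesis
      by (auto simp: special_part_def simp del: One_nat_def)
  next
    case 6: False
    with False have "b = 6 \<or> b = 7 \<or> b = 8 \<or> b = 9 \<or> b = 10"
      by linarith
    then show ?thesis
      by (auto simp: special_part_def simp del: One_nat_def)
  qed
qed

lemma hits_simps [simp]: "hits d [] = 0" "hits d (b # bs) = of_bool (d dvd Suc b) + hits d bs"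
  by (simp_all add: hits_def)

lemma sum_special_part:
  "(\<Sum>b\<leftarrow>bs. special_part b) =
     hits 2 bs + 2 * hits 3 bs + 2 * hits 4 bs + 4 * hits 5 bs + 2 * hits 6 bs"
  by (induction bs) (simp_all add: special_part_def)

lemma hits_pos: "b \<in> set bs \<Longrightarrow> d dvd Suc b \<Longrightarrow> hits d bs \<ge> 1"
  by (induction bs) auto

definition small_lengths :: "nat set" where
  "small_lengths = {1, 2, 3, 4, 5, 6, 7, 8, 9, 10, 12, 13}"

context
  fixes bs :: "nat list" and Q :: "real poly" and t1 t2 t3 t4 t5 :: nat
  assumes ge_1: "\<forall>b\<in>set bs. b \<ge> 1"
    and factorization: "starlike_poly bs = special_poly t1 t2 t3 t4 t5 * Q"
    and Q_special: "poly Q 0 \<noteq> 0" "poly Q 1 \<noteq> 0" "poly Q (sqrt 2) \<noteq> 0" "poly Q golden \<noteq> 0"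
      "poly Q (sqrt 3) \<noteq> 0"
begin

lemma Q_nonzero: "Q \<noteq> 0"
  using Q_special by auto

lemma order_starlike_eq:
  "order 0 (starlike_poly bs :: real poly) = t1" "order 1 (starlike_poly bs :: real poly) = t2"
  "order (sqrt 2) (starlike_poly bs) = t3" "order golden (starlike_poly bs) = t4"
  "order (sqrt 3) (starlike_poly bs) = t5"
  using Q_nonzero Q_special unfolding factorization
  by (simp_all add: order_mult order_special_poly_at order_0I)

lemmas exponent_eqs =
  order_at_0[OF ge_1, unfolded order_starlike_eq]
  order_at_1[OF ge_1, unfolded order_starlike_eq]
  order_at_sqrt2[OF ge_1, unfolded order_starlike_eq]
  order_at_golden[OF ge_1, unfolded order_starlike_eq]
  order_at_sqrt3[OF ge_1, unfolded order_starlike_eq]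

lemma degree_eq: "Suc (sum_list bs) = t1 + 2 * t2 + 2 * t3 + 4 * t4 + 2 * t5 + degree Q"
proof -
  have "Suc (sum_list bs) = degree (starlike_poly bs :: real poly)"
    using degree_starlike_poly[OF ge_1, where ?'a = real] by simp
  also have "\<dots> = t1 + 2 * t2 + 2 * t3 + 4 * t4 + 2 * t5 + degree Q"
    unfolding factorization using Q_nonzero by (simp add: degree_mult_eq degree_special_poly)
  finally show ?thesis .
qed

text \<open>
  A root common to all the paths in question occurs in \<^term>\<open>starlike_poly bs\<close> once less often than
  in \<^term>\<open>paths_poly bs\<close>, and any other root at most once.  Comparing degrees leaves only \<open>14\<close> for a
  branch length plus its number of special eigenvalues.
\<close>
lemma lengths_small:
  assumes "degree Q \<le> 4"
  shows "set bs \<subseteq> small_lengths"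
proof
  fix b assume b: "b \<in> set bs"
  have "b - special_part b \<le> (\<Sum>b\<leftarrow>bs. b - special_part b)"
    using b by (intro member_le_sum_list) auto
  also have "\<dots> + (\<Sum>b\<leftarrow>bs. special_part b) = sum_list bs"
    unfolding sum_list_addf[symmetric] using ge_1 special_part_le
    by (simp add: map_idI)
  finally have *: "b - special_part b + (\<Sum>b\<leftarrow>bs. special_part b) \<le> sum_list bs"
    by simp
  \<comment> \<open>A pole caused by \<open>b\<close> gives exponent \<open>hits - 1\<close>; in
    every other case the exponent is at most \<open>hits + 1\<close>.\<close>
  have "t1 + 2 * of_bool (2 dvd Suc b) \<le> hits 2 bs + 1" "t2 + 2 * of_bool (3 dvd Suc b) \<le> hits 3 bs + 1"
    "t3 + 2 * of_bool (4 dvd Suc b) \<le> hits 4 bs + 1" "t4 + 2 * of_bool (5 dvd Suc b) \<le> hits 5 bs + 1"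
    "t5 + 2 * of_bool (6 dvd Suc b) \<le> hits 6 bs + 1"
    using hits_pos[OF b, of 2] hits_pos[OF b, of 3] hits_pos[OF b, of 4] hits_pos[OF b, of 5]
      hits_pos[OF b, of 6]
    by (auto simp: exponent_eqs of_bool_def)
  moreover have "special_part b \<le> b"
    using special_part_le ge_1 b by blast
  with * have "b + (\<Sum>b\<leftarrow>bs. special_part b) \<le> sum_list bs + special_part b"
    by linarith
  \<comment> \<open>Weighting these inequalities by the degrees costs 11 in total, \<open>Q\<close>
    adds at most 4, and the center accounts for 1: \<open>14 = 11 + 4 - 1\<close>.\<close>
  ultimately have bound: "b + special_part b \<le> 14"
    using degree_eq assms unfolding sum_special_part unfolding special_part_def by linarith
  have "b \<ge> 1"
    using b ge_1 by auto
  show "b \<in> small_lengths"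
  proof (cases "b \<le> 7")
    case True
    with \<open>b \<ge> 1\<close> have "b = 1 \<or> b = 2 \<or> b = 3 \<or> b = 4 \<or> b = 5 \<or> b = 6 \<or> b = 7"
      by linarith
    then show ?thesis
      by (auto simp: small_lengths_def)
  next
    case False
    moreover have "b \<le> 14"
      using bound by simp
    ultimately have "b = 8 \<or> b = 9 \<or> b = 10 \<or> b = 11 \<or> b = 12 \<or> b = 13 \<or> b = 14"
      by linarith
    then show ?thesis
      using bound by (auto simp: special_part_def small_lengths_def)
  qed
qed

end

lemma sum_list_eq_sum_count:
  assumes "set bs \<subseteq> A" "finite A"
  shows "(\<Sum>b\<leftarrow>bs. g b) = (\<Sum>b\<in>A. of_nat (count_list bs b) * (g b :: 'a::comm_semiring_1))"
  using assms(1)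
proof (induction bs)
  case (Cons b bs)
  have "(\<Sum>c\<in>A. of_nat (count_list (b # bs) c) * g c) =
      (\<Sum>c\<in>A. (if c = b then g c else 0) + of_nat (count_list bs c) * g c)"
    by (intro sum.cong) (auto simp: algebra_simps)
  also have "\<dots> = g b + (\<Sum>b\<leftarrow>bs. g b)"
    using Cons assms(2) by (simp add: sum.distrib)
  finally show ?case
    by simp
qed simp

text \<open>Sums over the branches become sums over the admissible lengths. \<open>Q\<close> stays
  general because it is the product of the quadratic factors in the main case and 1 in the golden
  one.\<close>

lemma multiplicity_system_counts:
  fixes bs :: "nat list" and Q :: "real poly"
  assumes ge_1: "\<forall>b\<in>set bs. b \<ge> 1"
    and factorization: "starlike_poly bs = special_poly t1 t2 t3 t4 t5 * Q"
    and Q_special: "poly Q 0 \<noteq> 0" "poly Q 1 \<noteq> 0" "poly Q (sqrt 2) \<noteq> 0" "poly Q golden \<noteq> 0"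
      "poly Q (sqrt 3) \<noteq> 0"
    and Q: "degree Q \<le> 4" and length: "length bs \<ge> 3"
    and n: "n = (\<lambda>i. int (count_list bs i))"
    and e: "e1 = int t1 - int (hits 2 bs)" "e2 = int t2 - int (hits 3 bs)" "e3 = int t3 - int (hits 4 bs)"
      "e4 = int t4 - int (hits 5 bs)" "e5 = int t5 - int (hits 6 bs)"
  shows "multiplicity_system (n 1) (n 2) (n 3) (n 4) (n 5) (n 6) (n 7) (n 8) (n 9) (n 10) (n 12) (n 13)
      e1 e2 e3 e4 e5" (is ?system)
    and "6 * n 6 + 4 * n 7 + 6 * n 8 + 4 * n 9 + 10 * n 10 + 12 * n 12 + 12 * n 13
      = int (degree Q) - 1 + e1 + 2 * e2 + 2 * e3 + 4 * e4 + 2 * e5" (is ?degree)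
    and "int (hits 2 bs) = n 1 + n 3 + n 5 + n 7 + n 9 + n 13" (is ?h2)
    and "int (hits 3 bs) = n 2 + n 5 + n 8" (is ?h3)
    and "int (hits 4 bs) = n 3 + n 7" (is ?h4)
    and "int (hits 5 bs) = n 4 + n 9" (is ?h5)
    and "int (hits 6 bs) = n 5" (is ?h6)
proof -
  note exps = exponent_eqs[OF ge_1 factorization Q_special]
  have sum: "(\<Sum>b\<leftarrow>bs. g b) = (\<Sum>b\<in>small_lengths. n b * g b)" for g :: "nat \<Rightarrow> int"
    using sum_list_eq_sum_count[OF lengths_small[OF ge_1 factorization Q_special Q], of g]
    by (simp add: n small_lengths_def del: One_nat_def)
  have hits: "int (hits d bs) = (\<Sum>b\<leftarrow>bs. of_bool (d dvd Suc b))" for d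
    by (induction bs) simp_all
  have expand: "(\<Sum>b\<in>small_lengths. g b) =
      g 1 + g 2 + g 3 + g 4 + g 5 + g 6 + g 7 + g 8 + g 9 + g 10 + g 12 + g 13" for g :: "nat \<Rightarrow> int"
    by (simp add: small_lengths_def del: One_nat_def)
  show h2: ?h2
    unfolding hits sum expand by (simp del: One_nat_def)
  show h3: ?h3
    unfolding hits sum expand by (simp del: One_nat_def)
  show h4: ?h4
    unfolding hits sum expand by (simp del: One_nat_def)
  show h5: ?h5
    unfolding hits sum expand by (simp del: One_nat_def)
  show h6: ?h6
    unfolding hits sum expand by (simp del: One_nat_def)
  have nonneg: "n i \<ge> 0" for i
    by (simp add: n)
  have total: "n 1 + n 2 + n 3 + n 4 + n 5 + n 6 + n 7 + n 8 + n 9 + n 10 + n 12 + n 13 \<ge> 3"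
  proof -
    have "int (length bs) = (\<Sum>b\<leftarrow>bs. 1)"
      by (induction bs) simp_all
    then show ?thesis
      using length unfolding sum expand by simp
  qed
  have e1: "e1 = (if n 1 + n 3 + n 5 + n 7 + n 9 + n 13 = 0 then 1 else -1)"
    unfolding h2[symmetric] e exps(1) by simp
  have "(\<Sum>b\<leftarrow>bs. of_bool (b mod 3 = 1)) = n 1 + n 4 + n 7 + n 10 + n 13"
    unfolding sum expand by (simp del: One_nat_def)
  then have e2: "e2 = (if n 2 + n 5 + n 8 = 0 then of_bool (n 1 + n 4 + n 7 + n 10 + n 13 = 1) else -1)"
    unfolding h3[symmetric] e exps(2) by simp
  have "(\<Sum>b\<leftarrow>bs. sqrt2_weight b) = n 1 + 2 * n 2 + n 5 + 2 * n 6 + n 9 + 2 * n 10 + n 13"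
    unfolding sum expand by (simp add: sqrt2_weight_def del: One_nat_def)
  then have e3: "e3 = (if n 3 + n 7 = 0
      then of_bool (n 1 + 2 * n 2 + n 5 + 2 * n 6 + n 9 + 2 * n 10 + n 13 = 2) else -1)"
    unfolding h4[symmetric] e exps(3) by simp
  have "(\<Sum>b\<leftarrow>bs. of_bool (b mod 5 = 2) - of_bool (b mod 5 = 1)) = (n 2 + n 7 + n 12) - (n 1 + n 6)"
    "(\<Sum>b\<leftarrow>bs. of_bool (b mod 5 = 1) + of_bool (b mod 5 = 3)) = n 1 + n 6 + n 3 + n 8 + n 13"
    unfolding sum expand by (simp_all del: One_nat_def)
  then have e4: "e4 = (if n 4 + n 9 = 0
      then of_bool (n 1 + n 6 = n 2 + n 7 + n 12 \<and> n 1 + n 6 + n 3 + n 8 + n 13 = 1) else -1)"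
    unfolding h5[symmetric] e exps(4) by auto
  have "(\<Sum>b\<leftarrow>bs. sqrt3_weight b) =
      2 * n 1 + 3 * n 2 + 4 * n 3 + 6 * n 4 + 2 * n 7 + 3 * n 8 + 4 * n 9 + 6 * n 10 + 2 * n 13"
    unfolding sum expand by (simp add: sqrt3_weight_def del: One_nat_def)
  then have e5: "e5 = (if n 5 = 0 then of_bool
      (2 * n 1 + 3 * n 2 + 4 * n 3 + 6 * n 4 + 2 * n 7 + 3 * n 8 + 4 * n 9 + 6 * n 10 + 2 * n 13 = 6) else -1)"
    unfolding h6[symmetric] e exps(5) by simp
  show ?system
    by (rule multiplicity_system.intro) (use nonneg total e1 e2 e3 e4 e5 in blast)+
  have "int (sum_list bs) = (\<Sum>b\<leftarrow>bs. int b)"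
    by (induction bs) simp_all
  then have "int (sum_list bs) = n 1 + 2 * n 2 + 3 * n 3 + 4 * n 4 + 5 * n 5 + 6 * n 6 + 7 * n 7 +
      8 * n 8 + 9 * n 9 + 10 * n 10 + 12 * n 12 + 13 * n 13"
    unfolding sum expand by simp
  moreover have "int (Suc (sum_list bs)) = int (t1 + 2 * t2 + 2 * t3 + 4 * t4 + 2 * t5 + degree Q)"
    unfolding degree_eq[OF ge_1 factorization Q_special] ..
  ultimately show ?degree
    unfolding e h2 h3 h4 h5 h6 by simp
qed

section \<open>The five families\<close>

lemma is_T_cong:
  assumes "is_T T ns" "\<And>i. count_list (branch_lengths ns) i = count_list (branch_lengths ns') i"
  shows "is_T T ns'"
  using assms(1) starlike_cong[OF assms(2)] by (simp add: is_T_def)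

section \<open>Explicit characteristic polynomials\<close>

lemma path_poly_small:
  "path_poly (Suc 0) = [:0, 1:]" "path_poly 2 = [:-1, 0, 1:]" "path_poly 3 = [:0, 1:] * [:-2, 0, 1:]"
  "path_poly 4 = [:1, 0, -3, 0, 1:]" "path_poly 5 = [:0, 1:] * [:-1, 0, 1:] * [:-3, 0, 1:]"
  by (simp_all add: eval_nat_numeral one_pCons)

lemma starlike_poly_replicate:
  "starlike_poly (replicate (Suc n) b) =
     path_poly b ^ n * (path_poly b * [:0, 1:] - of_nat (Suc n) * path_poly (b - 1))"
  using starlike_poly_replicate_append[of n b "[]"] by simp

lemma starlike_poly_family1:
  assumes "n \<ge> 1"
  shows "starlike_poly (branch_lengths [0, 0, 1, 0, n]) = special_poly n (n - 1) 0 1 (n - 1) * biquad (int (4 + n)) (int (3 + 2 * n))"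
proof -
  obtain m where n: "n = Suc m"
    using assms by (cases n) auto
  have bs: "branch_lengths [0, 0, 1, 0, n] = 3 # replicate n 5"
    by (simp add: branch_lengths_def upt_conv_Cons)
  have poly: "starlike_poly (3 # replicate n 5) = path_poly 5 ^ m * (path_poly 3 * (path_poly 5 * [:0, 1:] - of_nat n * path_poly 4) - path_poly 2 * path_poly 5 :: int poly)"
    unfolding n
    by (simp only: starlike_poly.simps starlike_poly_replicate starlike_poly_replicate_append
        paths_poly_replicate paths_poly_simps power_Suc)
      (simp add: algebra_simps del: mult_pCons_left mult_pCons_right)
  have eq: "path_poly 3 * (path_poly 5 * [:0, 1:] - of_nat n * path_poly 4) - path_poly 2 * path_poly 5 = [:0, 1:] * [:1, 0, -3, 0, 1:] * biquad (int (4 + n)) (int (3 + 2 * n))"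
    by (simp add: path_poly_small biquad_def of_nat_poly numeral_poly)
  show ?thesis
    unfolding bs poly eq
    by (simp add: n path_poly_small(5) special_poly_def power_mult_distrib mult_ac
        del: mult_pCons_left mult_pCons_right)
qed

lemma starlike_poly_family2:
  assumes "n \<ge> 1"
  shows "starlike_poly (branch_lengths [0, 0, 0, n]) = special_poly 1 0 0 (n - 1) 0 * biquad (int (3 + n)) (int (1 + 2 * n))"
proof -
  obtain m where n: "n = Suc m"
    using assms by (cases n) auto
  have bs: "branch_lengths [0, 0, 0, n] = replicate n 4"
    by (simp add: branch_lengths_def upt_conv_Cons)
  have poly: "starlike_poly (replicate n 4) = path_poly 4 ^ m * (path_poly 4 * [:0, 1:] - of_nat n * path_poly 3 :: int poly)"
    unfolding n
    by (simp only: starlike_poly.simps starlike_poly_replicate starlike_poly_replicate_append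
        paths_poly_replicate paths_poly_simps power_Suc)
      (simp add: algebra_simps del: mult_pCons_left mult_pCons_right)
  have eq: "path_poly 4 * [:0, 1:] - of_nat n * path_poly 3 = [:0, 1:] * biquad (int (3 + n)) (int (1 + 2 * n))"
    by (simp add: path_poly_small biquad_def of_nat_poly numeral_poly)
  show ?thesis
    unfolding bs poly eq
    by (simp add: n path_poly_small(4) special_poly_def power_mult_distrib mult_ac
        del: mult_pCons_left mult_pCons_right)
qed

lemma starlike_poly_family3:
  assumes "n \<ge> 1"
  shows "starlike_poly (branch_lengths [2, 0, 0, n]) = special_poly 1 0 1 (n - 1) 0 * biquad (int (3 + n)) 1"
proof -
  obtain m where n: "n = Suc m"
    using assms by (cases n) auto
  have bs: "branch_lengths [2, 0, 0, n] = 1 # 1 # replicate n 4"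
    by (simp add: branch_lengths_def upt_conv_Cons numeral_eq_Suc)
  have poly: "starlike_poly (1 # 1 # replicate n 4) = path_poly 4 ^ m * (path_poly 1 * path_poly 1 * (path_poly 4 * [:0, 1:] - of_nat n * path_poly 3) - 2 * path_poly 1 * path_poly 4 :: int poly)"
    unfolding n
    by (simp only: starlike_poly.simps starlike_poly_replicate starlike_poly_replicate_append
        paths_poly_replicate paths_poly_simps power_Suc)
      (simp add: algebra_simps del: mult_pCons_left mult_pCons_right)
  have eq: "path_poly 1 * path_poly 1 * (path_poly 4 * [:0, 1:] - of_nat n * path_poly 3) - 2 * path_poly 1 * path_poly 4 = [:0, 1:] * [:-2, 0, 1:] * biquad (int (3 + n)) 1"
    by (simp add: path_poly_small biquad_def of_nat_poly numeral_poly)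
  show ?thesis
    unfolding bs poly eq
    by (simp add: n path_poly_small(4) special_poly_def power_mult_distrib mult_ac
        del: mult_pCons_left mult_pCons_right)
qed

text \<open>This is the exceptional solution of the linear system; its two parameters are needed to
  refute it.\<close>

lemma starlike_poly_P2_P4:
  assumes "n \<ge> 1"
  shows "starlike_poly (branch_lengths [0, 1, 0, n]) = special_poly 1 0 1 (n - 1) 0 * biquad (int (3 + n)) (int (1 + n))"
proof -
  obtain m where n: "n = Suc m"
    using assms by (cases n) auto
  have bs: "branch_lengths [0, 1, 0, n] = 2 # replicate n 4"
    by (simp add: branch_lengths_def upt_conv_Cons)
  have poly: "starlike_poly (2 # replicate n 4) = path_poly 4 ^ m * (path_poly 2 * (path_poly 4 * [:0, 1:] - of_nat n * path_poly 3) - path_poly 1 * path_poly 4 :: int poly)"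
    unfolding n
    by (simp only: starlike_poly.simps starlike_poly_replicate starlike_poly_replicate_append
        paths_poly_replicate paths_poly_simps power_Suc)
      (simp add: algebra_simps del: mult_pCons_left mult_pCons_right)
  have eq: "path_poly 2 * (path_poly 4 * [:0, 1:] - of_nat n * path_poly 3) - path_poly 1 * path_poly 4 = [:0, 1:] * [:-2, 0, 1:] * biquad (int (3 + n)) (int (1 + n))"
    by (simp add: path_poly_small biquad_def of_nat_poly numeral_poly)
  show ?thesis
    unfolding bs poly eq
    by (simp add: n path_poly_small(4) special_poly_def power_mult_distrib mult_ac
        del: mult_pCons_left mult_pCons_right)
qed

lemma starlike_poly_family5:
  assumes "n1 \<ge> 1" "n2 \<ge> 1"
  shows "starlike_poly (branch_lengths [n1, n2]) = special_poly (n1 - 1) (n2 - 1) 0 0 0 * biquad (int (1 + n1 + n2)) (int n1)"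
proof -
  obtain m1 m2 where n: "n1 = Suc m1" "n2 = Suc m2"
    using assms by (cases n1; cases n2) auto
  have bs: "branch_lengths [n1, n2] = replicate n1 1 @ replicate n2 2"
    by (simp add: branch_lengths_def upt_conv_Cons)
  have poly: "starlike_poly (replicate n1 1 @ replicate n2 2) = path_poly 1 ^ m1 * path_poly 2 ^ m2 * (path_poly 1 * (path_poly 2 * [:0, 1:] - of_nat n2 * path_poly 1) - of_nat n1 * path_poly 2 :: int poly)"
    unfolding n
    by (simp only: starlike_poly.simps starlike_poly_replicate starlike_poly_replicate_append
        paths_poly_replicate paths_poly_simps power_Suc)
      (simp add: algebra_simps del: mult_pCons_left mult_pCons_right)
  have eq: "path_poly 1 * (path_poly 2 * [:0, 1:] - of_nat n2 * path_poly 1) - of_nat n1 * path_poly 2 = 1 * biquad (int (1 + n1 + n2)) (int n1)"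
    by (simp add: path_poly_small biquad_def of_nat_poly numeral_poly)
  show ?thesis
    unfolding bs poly eq
    by (simp add: n path_poly_small(1,2) special_poly_def power_mult_distrib mult_ac
        del: mult_pCons_left mult_pCons_right)
qed

text \<open>Without branches of length 1 all powers of \<open>x\<close> come from
  \<open>p\<^sub>3\<close>. Otherwise the bracket that remains after splitting off the common powers
  supplies one more factor \<open>x\<close>, and the exponent is \<open>n1 + n3 - 1\<close> in both
  cases.\<close>

lemma starlike_poly_family4:
  assumes "n3 \<ge> 1"
  shows "starlike_poly (branch_lengths [n1, 0, n3]) =
    special_poly (n1 + n3 - 1) 0 (n3 - 1) 0 0 * biquad (int (2 + n1 + n3)) (int (2 * n1 + n3))"
proof (cases n1)
  case 0
  obtain m where n: "n3 = Suc m"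
    using assms by (cases n3) auto
  have bs: "branch_lengths [n1, 0, n3] = replicate n3 3"
    by (simp add: branch_lengths_def upt_conv_Cons 0)
  have poly: "starlike_poly (replicate n3 3) =
      path_poly 3 ^ m * (path_poly 3 * [:0, 1:] - of_nat n3 * path_poly 2 :: int poly)"
    unfolding n starlike_poly_replicate by simp
  have eq: "path_poly 3 * [:0, 1:] - of_nat n3 * path_poly 2 = biquad (int (2 + n3)) (int n3)"
    by (simp add: path_poly_small biquad_def of_nat_poly numeral_poly)
  show ?thesis
    unfolding bs poly eq
    by (simp add: n 0 path_poly_small(3) special_poly_def power_mult_distrib mult_ac
        del: mult_pCons_left mult_pCons_right)
next
  case (Suc m1)
  obtain m where n: "n3 = Suc m"
    using assms by (cases n3) auto
  have bs: "branch_lengths [n1, 0, n3] = replicate n1 1 @ replicate n3 3"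
    by (simp add: branch_lengths_def upt_conv_Cons)
  have poly: "starlike_poly (replicate n1 1 @ replicate n3 3) = path_poly 1 ^ m1 * path_poly 3 ^ m *
      (path_poly 1 * (path_poly 3 * [:0, 1:] - of_nat n3 * path_poly 2) - of_nat n1 * path_poly 3 :: int poly)"
    unfolding Suc n
    by (simp only: starlike_poly_replicate starlike_poly_replicate_append paths_poly_replicate power_Suc)
      (simp add: algebra_simps del: mult_pCons_left mult_pCons_right)
  have eq: "path_poly 1 * (path_poly 3 * [:0, 1:] - of_nat n3 * path_poly 2) - of_nat n1 * path_poly 3
      = [:0, 1:] * biquad (int (2 + n1 + n3)) (int (2 * n1 + n3))"
    by (simp add: path_poly_small biquad_def of_nat_poly numeral_poly)
  show ?thesis
    unfolding bs poly eq
    by (simp add: Suc n path_poly_small(1,3) special_poly_def power_mult_distrib power_add mult_ac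
        del: mult_pCons_left mult_pCons_right)
qed

section \<open>A sufficient condition for form (II)\<close>

lemma poly_special_poly_eq_0_imp:
  assumes "poly (map_poly real_of_int (special_poly t1 t2 t3 t4 t5)) x = 0"
  shows "x \<le> 2"
proof (rule ccontr)
  assume "\<not> x \<le> 2"
  then have sq: "x * x > 2 * 2"
    by (intro mult_strict_mono) auto
  then have "(x * x) * (x * x - 3) > 0"
    by (intro mult_pos_pos[of "x * x"]; simp)
  then have "1 + x * (x * (x * x - 3)) > 0"
    by (simp add: mult.assoc)
  with sq show False
    using assms \<open>\<not> x \<le> 2\<close> unfolding of_int_special_poly
    by (auto simp: special_poly_def algebra_simps)
qed

lemma form_II_I:
  assumes "admissible a b" "(b + 4)\<^sup>2 \<le> 4 * a\<^sup>2"
    and "graph_char_poly T = special_poly t1 t2 t3 t4 t5 * biquad (a\<^sup>2 - 2 * b) (b\<^sup>2)"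
  shows "form_II T"
proof -
  have "biquad (a\<^sup>2 - 2 * b) (b\<^sup>2) \<noteq> 0"
    by (simp add: biquad_def)
  then have "graph_char_poly T \<noteq> 0"
    using assms(3) by simp
  moreover have "graph_char_poly T = special_poly t1 t2 t3 t4 t5 * quad a b * quad' a b"
    unfolding assms(3) mult.assoc quad_mult_quad' ..
  ultimately have "poly (map_poly real_of_int (quad a b)) (lambda1 T) = 0"
    using lambda1_quad assms(1,2) poly_special_poly_eq_0_imp by blast
  then show ?thesis
    unfolding form_II_def using assms(1,3) form_II_poly_eq by metis
qed

section \<open>From form (II) to the families\<close>

lemma sqrt3_le_lambda1_golden:
  assumes "poly (map_poly real_of_int (quad 1 (-1))) (lambda1 T) = 0"
  shows "\<not> sqrt 3 \<le> lambda1 T"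
proof
  assume "sqrt 3 \<le> lambda1 T"
  then have "lambda1 T > golden" "lambda1 T + golden > 1"
    using golden_bounds by linarith+
  then have "(lambda1 T - golden) * (lambda1 T + golden - 1) > 0"
    by (intro mult_pos_pos) auto
  moreover have "(lambda1 T - golden) * (lambda1 T + golden - 1) = lambda1 T * lambda1 T - lambda1 T - 1"
    using golden_square by (simp add: algebra_simps)
  ultimately show False
    using assms by (simp add: power2_eq_square algebra_simps)
qed

text \<open>For \<open>a = 1\<close>, \<open>b = -1\<close> the quadratic factors merely raise the
  exponent of the golden factor to \<open>Suc t4\<close>. The assumption on \<open>lambda1 T\<close>
  excludes the eigenvalue \<open>sqrt 3\<close>, and the system with \<open>Q = 1\<close> then has
  no solution.\<close>

lemma form_II_not_golden:
  assumes "is_T T ns" "length (branch_lengths ns) \<ge> 3"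
    and "graph_char_poly T = special_poly t1 t2 t3 t4 t5 * biquad (1\<^sup>2 - 2 * (-1)) ((-1)\<^sup>2)"
    and "poly (map_poly real_of_int (quad 1 (-1))) (lambda1 T) = 0"
  shows False
proof -
  let ?bs = "branch_lengths ns"
  have eq: "starlike_poly ?bs = (special_poly t1 t2 t3 (Suc t4) t5 :: int poly)"
    using assms(3) unfolding graph_char_poly_is_T[OF assms(1)]
    by (simp add: special_poly_def biquad_def mult_ac del: mult_pCons_left mult_pCons_right)
  then have eq': "starlike_poly ?bs = special_poly t1 t2 t3 (Suc t4) t5 * (1 :: real poly)"
    using of_int_starlike_poly[of ?bs] of_int_special_poly[of t1 t2 t3 "Suc t4" t5] by simp
  have "t5 = 0"
  proof (rule ccontr)
    assume "t5 \<noteq> 0"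
    then have "poly (starlike_poly ?bs) (sqrt 3) = 0"
      unfolding eq' by (simp add: special_poly_def)
    then have "graph_eigenvalue T (sqrt 3)"
      unfolding graph_eigenvalue_iff graph_char_poly_is_T[OF assms(1)] of_int_starlike_poly .
    moreover have "graph_char_poly T \<noteq> 0"
      unfolding graph_char_poly_is_T[OF assms(1)] eq by simp
    ultimately show False
      using graph_eigenvalue_le_lambda1 sqrt3_le_lambda1_golden[OF assms(4)] by blast
  qed
  define n where "n = (\<lambda>i. int (count_list ?bs i))"
  define e1 e2 e3 e4 e5 where e: "e1 = int t1 - int (hits 2 ?bs)" "e2 = int t2 - int (hits 3 ?bs)"
      "e3 = int t3 - int (hits 4 ?bs)" "e4 = int (Suc t4) - int (hits 5 ?bs)" "e5 = int t5 - int (hits 6 ?bs)"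
  have "poly (1 :: real poly) x \<noteq> 0" for x
    by simp
  note * = multiplicity_system_counts[OF branch_lengths_ge_1 eq' this this this this this _ assms(2) n_def e]
  have sys: "multiplicity_system (n 1) (n 2) (n 3) (n 4) (n 5) (n 6) (n 7) (n 8) (n 9) (n 10) (n 12) (n 13)
      e1 e2 e3 e4 e5"
    using *(1) by simp
  interpret multiplicity_system "n 1" "n 2" "n 3" "n 4" "n 5" "n 6" "n 7" "n 8" "n 9" "n 10" "n 12" "n 13"
      e1 e2 e3 e4 e5
    by (fact sys)
  \<comment> \<open>\<open>e5\<close> is -1, 0 or 1, while \<open>n 5 \<ge> 0\<close>; this yields
    both bounds.\<close>
  have "e5 = - n 5"
    using *(7) e(5) \<open>t5 = 0\<close> by simp
  moreover have "e5 \<le> 0" "n 5 \<le> 1"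
    using \<open>e5 = - n 5\<close> by (cases rule: e5_cases; linarith)+
  ultimately show False
    using no_solution_without_quad *(2) by simp
qed

lemma biquad_eq_iff [simp]: "biquad s p = biquad s' p' \<longleftrightarrow> s = s' \<and> p = p'"
  by (auto simp: biquad_def)

lemma form_II_imp_family:
  assumes T: "is_T T ns" and length: "length (branch_lengths ns) \<ge> 3" and "form_II T"
  shows "\<exists>a b. admissible a b \<and>
          ((\<exists>n5. family1 T a b n5) \<or> (\<exists>n4. family2 T a b n4) \<or> (\<exists>n4. family3 T a b n4) \<or>
           (\<exists>n1 n3. family4 T a b n1 n3) \<or> (\<exists>n1 n2. family5 T a b n1 n2))"
proof -
  let ?bs = "branch_lengths ns"
  obtain t1 t2 t3 t4 t5 a b where adm: "admissible a b"
    and char: "graph_char_poly T = special_poly t1 t2 t3 t4 t5 * biquad (a\<^sup>2 - 2 * b) (b\<^sup>2)"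
    and root: "poly (map_poly real_of_int (quad a b)) (lambda1 T) = 0"
    using assms(3) unfolding form_II_def form_II_poly_eq by blast
  have ab: "(a, b) \<noteq> (1, -1)"
  proof
    assume "(a, b) = (1, -1)"
    then have ab: "a = 1" "b = -1"
      by auto
    show False
      using form_II_not_golden[OF T length char[unfolded ab] root[unfolded ab]] .
  qed
  define Q where "Q = biquad (real_of_int (a\<^sup>2 - 2 * b)) (real_of_int (b\<^sup>2))"
  have eq: "starlike_poly ?bs = special_poly t1 t2 t3 t4 t5 * Q"
    using arg_cong[OF char, of "map_poly real_of_int"]
    unfolding graph_char_poly_is_T[OF T] of_int_starlike_poly of_int_poly_hom.hom_mult
      of_int_special_poly of_int_biquad Q_def .
  have Q: "poly Q 0 \<noteq> 0" "poly Q 1 \<noteq> 0" "poly Q (sqrt 2) \<noteq> 0" "poly Q golden \<noteq> 0" "poly Q (sqrt 3) \<noteq> 0"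
    using poly_biquad_special[OF adm] ab unfolding Q_def by auto
  have "degree Q = 4"
    by (simp add: Q_def biquad_def)
  define n where "n = (\<lambda>i. int (count_list ?bs i))"
  define e1 e2 e3 e4 e5 where e: "e1 = int t1 - int (hits 2 ?bs)" "e2 = int t2 - int (hits 3 ?bs)"
      "e3 = int t3 - int (hits 4 ?bs)" "e4 = int t4 - int (hits 5 ?bs)" "e5 = int t5 - int (hits 6 ?bs)"
  note * = multiplicity_system_counts[OF branch_lengths_ge_1 eq Q _ length n_def e, unfolded \<open>degree Q = 4\<close>, OF order_refl]
  interpret multiplicity_system "n 1" "n 2" "n 3" "n 4" "n 5" "n 6" "n 7" "n 8" "n 9" "n 10" "n 12" "n 13"
      e1 e2 e3 e4 e5
    by (rule *(1))
  have weight: "6 * n 6 + 4 * n 7 + 6 * n 8 + 4 * n 9 + 10 * n 10 + 12 * n 12 + 12 * n 13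
      = 3 + e1 + 2 * e2 + 2 * e3 + 4 * e4 + 2 * e5"
    using *(2) by simp
  have large: "n 6 = 0" "n 7 = 0" "n 8 = 0" "n 9 = 0" "n 10 = 0" "n 12 = 0" "n 13 = 0"
    using large_zero[OF weight] by auto
  have t: "int t1 = e1 + n 1 + n 3 + n 5" "int t2 = e2 + n 2 + n 5" "int t3 = e3 + n 3" "int t4 = e4 + n 4"
    "int t5 = e5 + n 5"
    using e *(3-7) large by simp_all
  define c where "c = count_list ?bs"
  have n: "n i = int (c i)" for i
    by (simp add: n_def c_def)
  have "set ?bs \<subseteq> small_lengths"
    using lengths_small[OF branch_lengths_ge_1 eq Q] \<open>degree Q = 4\<close> by simp
  moreover have "c i = 0" if "i \<in> {6, 7, 8, 9, 10, 12, 13}" for i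
    using that large by (auto simp: n)
  ultimately have c0: "c i = 0" if "i \<notin> {1, 2, 3, 4, 5}" for i
    using that by (cases "i \<in> small_lengths") (auto simp: small_lengths_def c_def count_list_0_iff)
  have "count_list ?bs i = count_list (branch_lengths [c 1, c 2, c 3, c 4, c 5]) i" for i
  proof (cases "i \<in> {1, 2, 3, 4, 5}")
    case True
    then show ?thesis
      by (auto simp: c_def count_branch_lengths)
  next
    case False
    moreover from this have "\<not> (1 \<le> i \<and> i \<le> 5)"
      by auto
    ultimately show ?thesis
      using c0[of i] by (auto simp: c_def count_branch_lengths)
  qed
  then have T5: "is_T T [c 1, c 2, c 3, c 4, c 5]"
    using T by (rule is_T_cong[rotated])
  have trim: "is_T T ns'"
    if "\<And>i. count_list (branch_lengths [c 1, c 2, c 3, c 4, c 5]) i = count_list (branch_lengths ns') i" for ns'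
    using is_T_cong[OF T5 that] .
  \<comment> \<open>Cancelling the common special factors leaves two biquadratic polynomials to be
    compared coefficientwise.\<close>
  have params: "a\<^sup>2 - 2 * b = s" "b\<^sup>2 = p"
    if "is_T T ns'" "starlike_poly (branch_lengths ns') = special_poly t1 t2 t3 t4 t5 * biquad s p" for ns' s p
    using char that by (simp_all add: graph_char_poly_is_T)
  have cnt: "c 1 + c 2 + c 3 + c 4 + c 5 \<ge> 3"
    using total large by (simp add: n)
  show ?thesis
    using weight
  proof (cases rule: solutions)
    case 1
    then have c: "c 1 \<ge> 1" "c 2 \<ge> 1" "c 3 = 0" "c 4 = 0" "c 5 = 0"
      by (simp_all add: n)
    have t': "t1 = c 1 - 1" "t2 = c 2 - 1" "t3 = 0" "t4 = 0" "t5 = 0"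
      using t 1 c by (simp_all add: n)
    have T': "is_T T [c 1, c 2]"
      by (rule trim) (auto simp: c count_branch_lengths nth_Cons')
    have "starlike_poly (branch_lengths [c 1, c 2]) =
        special_poly t1 t2 t3 t4 t5 * biquad (int (1 + c 1 + c 2)) (int (c 1))"
      unfolding t' by (rule starlike_poly_family5[OF c(1,2)])
    from params[OF T' this] have "family5 T a b (c 1) (c 2)"
      using T' c cnt by (simp add: family5_def power2_sum)
    then show ?thesis
      using adm by blast
  next
    case 2
    then have c: "c 2 = 0" "c 3 \<ge> 1" "c 4 = 0" "c 5 = 0"
      by (simp_all add: n)
    have t': "t1 = c 1 + c 3 - 1" "t2 = 0" "t3 = c 3 - 1" "t4 = 0" "t5 = 0"
      using t 2 c by (simp_all add: n)
    have T': "is_T T [c 1, 0, c 3]"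
      by (rule trim) (auto simp: c count_branch_lengths nth_Cons')
    have "starlike_poly (branch_lengths [c 1, 0, c 3]) =
        special_poly t1 t2 t3 t4 t5 * biquad (int (2 + c 1 + c 3)) (int (2 * c 1 + c 3))"
      unfolding t' by (rule starlike_poly_family4[OF c(2)])
    from params[OF T' this] have "family4 T a b (c 1) (c 3)"
      using T' c cnt by (simp add: family4_def power2_sum)
    then show ?thesis
      using adm by blast
  next
    case 3
    then have c: "c 1 = 2" "c 2 = 0" "c 3 = 0" "c 4 \<ge> 1" "c 5 = 0"
      unfolding n by linarith+
    have t': "t1 = 1" "t2 = 0" "t3 = 1" "t4 = c 4 - 1" "t5 = 0"
      using t 3 c by (simp_all add: n)
    have T': "is_T T [2, 0, 0, c 4]"
      by (rule trim) (auto simp: c c(1)[unfolded One_nat_def] count_branch_lengths nth_Cons')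
    have "starlike_poly (branch_lengths [2, 0, 0, c 4]) =
        special_poly t1 t2 t3 t4 t5 * biquad (int (3 + c 4)) 1"
      unfolding t' by (rule starlike_poly_family3[OF c(4)])
    note ab = params[OF T' this]
    then have "b = 1 \<or> b = -1"
      by (simp add: power2_eq_1_iff)
    then have "family3 T a b (c 4)"
      using ab T' c by (auto simp: family3_def)
    then show ?thesis
      using adm by blast
  next
    case 4
    then have c: "c 1 = 0" "c 2 = 1" "c 3 = 0" "c 4 \<ge> 2" "c 5 = 0"
      by (simp_all add: n)
    have t': "t1 = 1" "t2 = 0" "t3 = 1" "t4 = c 4 - 1" "t5 = 0"
      using t 4 c by (simp_all add: n)
    have T': "is_T T [0, 1, 0, c 4]"
      by (rule trim) (auto simp: c c(1)[unfolded One_nat_def] count_branch_lengths nth_Cons')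
    have "c 4 \<ge> 1"
      using c(4) by simp
    then have "starlike_poly (branch_lengths [0, 1, 0, c 4]) =
        special_poly t1 t2 t3 t4 t5 * biquad (int (3 + c 4)) (int (1 + c 4))"
      unfolding t' by (rule starlike_poly_P2_P4)
    note ab = params[OF T' this]
    \<comment> \<open>Eliminating \<open>c 4\<close> gives \<open>a^2 = (b + 1)^2 + 1\<close>. Over
      the integers this forces \<open>b = -1\<close>, whereas \<open>b^2 = 1 + c 4\<close> is at
      least 3.\<close>
    then have "(a - (b + 1)) * (a + (b + 1)) = 1"
      by (simp add: algebra_simps power2_eq_square)
    then have "b + 1 = 0"
      by (auto simp: zmult_eq_1_iff)
    then have "b\<^sup>2 = 1"
      by (simp add: eq_neg_iff_add_eq_0[symmetric])
    then show ?thesis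
      using ab(2) c(4) by simp
  next
    case 5
    then have c: "c 1 = 0" "c 2 = 0" "c 3 = 1" "c 4 = 0" "c 5 \<ge> 2"
      by (simp_all add: n)
    have t': "t1 = c 5" "t2 = c 5 - 1" "t3 = 0" "t4 = 1" "t5 = c 5 - 1"
      using t 5 c by (simp_all add: n)
    have T': "is_T T [0, 0, 1, 0, c 5]"
      by (rule trim) (auto simp: c c(1)[unfolded One_nat_def] count_branch_lengths nth_Cons')
    have "c 5 \<ge> 1"
      using c(5) by simp
    then have "starlike_poly (branch_lengths [0, 0, 1, 0, c 5]) =
        special_poly t1 t2 t3 t4 t5 * biquad (int (4 + c 5)) (int (3 + 2 * c 5))"
      unfolding t' by (rule starlike_poly_family1)
    note ab = params[OF T' this]
    have "real_of_int (b\<^sup>2) = real_of_int (int (3 + 2 * c 5))"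
      unfolding ab(2) ..
    then have "(real_of_int b)\<^sup>2 = real (3 + 2 * c 5)"
      by (simp only: of_int_power of_int_of_nat_eq)
    then have "family1 T a b (c 5)"
      using ab T' c by (simp add: family1_def power2_sum)
    then show ?thesis
      using adm by blast
  next
    case 6
    then have c: "c 1 = 0" "c 2 = 0" "c 3 = 0" "c 4 \<ge> 3" "c 5 = 0"
      by (simp_all add: n)
    have t': "t1 = 1" "t2 = 0" "t3 = 0" "t4 = c 4 - 1" "t5 = 0"
      using t 6 c by (simp_all add: n)
    have T': "is_T T [0, 0, 0, c 4]"
      by (rule trim) (auto simp: c c(1)[unfolded One_nat_def] count_branch_lengths nth_Cons')
    have "c 4 \<ge> 1"
      using c(4) by simp
    then have "starlike_poly (branch_lengths [0, 0, 0, c 4]) =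
        special_poly t1 t2 t3 t4 t5 * biquad (int (3 + c 4)) (int (1 + 2 * c 4))"
      unfolding t' by (rule starlike_poly_family2)
    note ab = params[OF T' this]
    have "real_of_int (b\<^sup>2) = real_of_int (int (1 + 2 * c 4))"
      unfolding ab(2) ..
    then have "(real_of_int b)\<^sup>2 = real (1 + 2 * c 4)"
      by (simp only: of_int_power of_int_of_nat_eq)
    then have "family2 T a b (c 4)"
      using ab T' c by (simp add: family2_def power2_sum)
    then show ?thesis
      using adm by blast
  qed
qed

section \<open>From the families to form (II)\<close>

lemma graph_char_poly_family1:
  assumes "family1 T a b n"
  shows "graph_char_poly T = special_poly n (n - 1) 0 1 (n - 1) * biquad (a\<^sup>2 - 2 * b) (b\<^sup>2)"
proof -
  have T: "is_T T [0, 0, 1, 0, n]" and n: "n \<ge> 1" "2 * a\<^sup>2 = (b + 2)\<^sup>2 + 1"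
    and "real n = (real_of_int b ^ 2 - 3) / 2"
    using assms by (auto simp: family1_def)
  then have "real_of_int (b\<^sup>2) = real_of_int (3 + 2 * int n)"
    by simp
  then have b: "b\<^sup>2 = 3 + 2 * int n"
    by (simp only: of_int_eq_iff)
  with n(2) have "a\<^sup>2 - 2 * b = 4 + int n"
    by (simp add: power2_sum)
  with b show ?thesis
    unfolding graph_char_poly_is_T[OF T] starlike_poly_family1[OF n(1)] by simp
qed

lemma graph_char_poly_family2:
  assumes "family2 T a b n"
  shows "graph_char_poly T = special_poly 1 0 0 (n - 1) 0 * biquad (a\<^sup>2 - 2 * b) (b\<^sup>2)"
proof -
  have T: "is_T T [0, 0, 0, n]" and n: "n \<ge> 1" "2 * a\<^sup>2 = (b + 2)\<^sup>2 + 1"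
    and "real n = (real_of_int b ^ 2 - 1) / 2"
    using assms by (auto simp: family2_def)
  then have "real_of_int (b\<^sup>2) = real_of_int (1 + 2 * int n)"
    by simp
  then have b: "b\<^sup>2 = 1 + 2 * int n"
    by (simp only: of_int_eq_iff)
  with n(2) have "a\<^sup>2 - 2 * b = 3 + int n"
    by (simp add: power2_sum)
  with b show ?thesis
    unfolding graph_char_poly_is_T[OF T] starlike_poly_family2[OF n(1)] by simp
qed

lemma graph_char_poly_family3:
  assumes "family3 T a b n"
  shows "graph_char_poly T = special_poly 1 0 1 (n - 1) 0 * biquad (a\<^sup>2 - 2 * b) (b\<^sup>2)"
proof -
  have T: "is_T T [2, 0, 0, n]" and n: "n \<ge> 1"
    and "a\<^sup>2 - 2 * b = 3 + int n" "b\<^sup>2 = 1"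
    using assms by (auto simp: family3_def)
  then show ?thesis
    unfolding graph_char_poly_is_T[OF T] starlike_poly_family3[OF n] by simp
qed

lemma graph_char_poly_family4:
  assumes "family4 T a b n1 n3"
  shows "graph_char_poly T =
    special_poly (n1 + n3 - 1) 0 (n3 - 1) 0 0 * biquad (a\<^sup>2 - 2 * b) (b\<^sup>2)"
proof -
  have T: "is_T T [n1, 0, n3]" and n: "n3 \<ge> 1"
    and "a\<^sup>2 - 2 * b = 2 + int n1 + int n3" "b\<^sup>2 = 2 * int n1 + int n3"
    using assms by (auto simp: family4_def power2_sum)
  then show ?thesis
    unfolding graph_char_poly_is_T[OF T] starlike_poly_family4[OF n] by simp
qed

lemma graph_char_poly_family5:
  assumes "family5 T a b n1 n2"
  shows "graph_char_poly T = special_poly (n1 - 1) (n2 - 1) 0 0 0 * biquad (a\<^sup>2 - 2 * b) (b\<^sup>2)"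
proof -
  have T: "is_T T [n1, n2]" and n: "n1 \<ge> 1" "n2 \<ge> 1"
    and "a\<^sup>2 - 2 * b = 1 + int n1 + int n2" "b\<^sup>2 = int n1"
    using assms by (auto simp: family5_def power2_sum)
  then show ?thesis
    unfolding graph_char_poly_is_T[OF T] starlike_poly_family5[OF n] by simp
qed

text \<open>It discards the few small parameters at which the estimate for the largest root
  fails.\<close>

lemma no_square_between:
  fixes k x :: int
  assumes "k \<ge> 0" "k\<^sup>2 < x\<^sup>2" "x\<^sup>2 < (k + 1)\<^sup>2"
  shows False
  using power2_less_imp_less[of k "\<bar>x\<bar>"] power2_less_imp_less[of "\<bar>x\<bar>" "k + 1"] assms by simp

text \<open>In every family only \<open>(b + 4)^2 \<le> 4 a^2\<close> has to be checked. With
  \<open>s = a^2 - 2b\<close> and \<open>p = b^2\<close> it reads \<open>p + 16 \<le> 4 s\<close>, a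
  linear condition on the numbers of branches.\<close>

lemma family_imp_form_II:
  assumes "admissible a b"
    and "family1 T a b n \<or> family2 T a b n \<or> family3 T a b n \<or> family4 T a b m n \<or> family5 T a b m n"
  shows "form_II T"
  using assms(2)
proof (elim disjE)
  assume fam: "family1 T a b n"
  then have "real n = (real_of_int b ^ 2 - 3) / 2" "n \<ge> 2" "2 * a\<^sup>2 = (b + 2)\<^sup>2 + 1"
    by (auto simp: family1_def)
  moreover from this have "real_of_int (b\<^sup>2) = real_of_int (3 + 2 * int n)"
    by simp
  then have "b\<^sup>2 = 3 + 2 * int n"
    by (simp only: of_int_eq_iff)
  ultimately have "(b + 4)\<^sup>2 \<le> 4 * a\<^sup>2"
    by (simp add: power2_sum)
  then show ?thesis
    using form_II_I[OF assms(1)] graph_char_poly_family1[OF fam] by blast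
next
  assume fam: "family2 T a b n"
  then have "real n = (real_of_int b ^ 2 - 1) / 2" "n \<ge> 3" "2 * a\<^sup>2 = (b + 2)\<^sup>2 + 1"
    by (auto simp: family2_def)
  moreover from this have "real_of_int (b\<^sup>2) = real_of_int (1 + 2 * int n)"
    by simp
  then have "b\<^sup>2 = 1 + 2 * int n"
    by (simp only: of_int_eq_iff)
  ultimately have "(b + 4)\<^sup>2 \<le> 4 * a\<^sup>2"
    by (simp add: power2_sum)
  then show ?thesis
    using form_II_I[OF assms(1)] graph_char_poly_family2[OF fam] by blast
next
  assume fam: "family3 T a b n"
  \<comment> \<open>The linear condition fails only for \<open>n = 1\<close>, where
    \<open>a^2\<close> would be 6 or 2.\<close>
  consider "b = 1" "a\<^sup>2 \<ge> 6" | "b = -1" "a\<^sup>2 \<ge> 2"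
    using fam by (auto simp: family3_def)
  then have "(b + 4)\<^sup>2 \<le> 4 * a\<^sup>2"
  proof cases
    case 1
    then show ?thesis
      using no_square_between[of 2 a] by force
  next
    case 2
    then show ?thesis
      using no_square_between[of 1 a] by force
  qed
  then show ?thesis
    using form_II_I[OF assms(1)] graph_char_poly_family3[OF fam] by blast
next
  assume fam: "family4 T a b m n"
  then have n: "n \<ge> 1" "m + n \<ge> 3" and s: "a\<^sup>2 - 2 * b = 2 + int m + int n"
    and p: "b\<^sup>2 = 2 * int m + int n"
    by (auto simp: family4_def power2_sum)
  \<comment> \<open>The condition becomes \<open>8 \<le> 2m + 3n\<close> and could fail only for
    \<open>m = 2\<close>, \<open>n = 1\<close>, where \<open>b^2\<close> would be 5.\<close>
  have "b\<^sup>2 \<noteq> 5"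
    using no_square_between[of 2 b] by auto
  then have "\<not> (m = 2 \<and> n = 1)"
    using p by auto
  then have "2 * m + 3 * n \<ge> 8"
    using n by linarith
  then have "(b + 4)\<^sup>2 \<le> 4 * a\<^sup>2"
    using s p by (simp add: power2_sum)
  then show ?thesis
    using form_II_I[OF assms(1)] graph_char_poly_family4[OF fam] by blast
next
  assume fam: "family5 T a b m n"
  then have n: "m \<ge> 1" "n \<ge> 1" "m + n \<ge> 3" and s: "a\<^sup>2 - 2 * b = 1 + int m + int n"
    and p: "b\<^sup>2 = int m"
    by (auto simp: family5_def power2_sum)
  \<comment> \<open>Here the condition is \<open>12 \<le> 3m + 4n\<close>. Of the allowed pairs only
    (2, 1) and (1, 2) violate it; they would require \<open>b^2 = 2\<close>, or \<open>a^2\<close>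
    equal to 6 or 2.\<close>
  have "\<not> (m = 2 \<and> n = 1)"
    using no_square_between[of 1 b] p by auto
  moreover have "\<not> (m = 1 \<and> n = 2)"
  proof
    assume mn: "m = 1 \<and> n = 2"
    then have "b = 1 \<or> b = -1"
      using p by (simp add: power2_eq_1_iff)
    then have "a\<^sup>2 = 6 \<or> a\<^sup>2 = 2"
      using s mn by auto
    then show False
      using no_square_between[of 2 a] no_square_between[of 1 a] by auto
  qed
  ultimately have "3 * m + 4 * n \<ge> 12"
    using n by linarith
  then have "(b + 4)\<^sup>2 \<le> 4 * a\<^sup>2"
    using s p by (simp add: power2_sum)
  then show ?thesis
    using form_II_I[OF assms(1)] graph_char_poly_family5[OF fam] by blast
qed

theorem theorem4p10:
  fixes T :: "('v, 'e) pre_digraph"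
  assumes "graph T"
    and "Digraph_Component.connected T"
    and "starlike_tree T"
    and "quadratic_graph T"
    and "has_proper_induced_K13 T"
  shows "(form_II T \<longleftrightarrow>
       (\<exists>a b. admissible a b \<and>
          ((\<exists>n5. family1 T a b n5) \<or>
           (\<exists>n4. family2 T a b n4) \<or>
           (\<exists>n4. family3 T a b n4) \<or>
           (\<exists>n1 n3. family4 T a b n1 n3) \<or>
           (\<exists>n1 n2. family5 T a b n1 n2)))) \<and>
     (\<forall>a b. admissible a b \<longrightarrow>
        (\<forall>n5. family1 T a b n5 \<longrightarrow> graph_char_poly T =
           \<X>^n5 * (\<X>^2 - 1)^(n5 - 1) * (\<X>^2 - \<X> - 1) * (\<X>^2 + \<X> - 1) * (\<X>^2 - 3)^(n5 - 1)
             * quad a b * quad' a b) \<and>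
        (\<forall>n4. family2 T a b n4 \<longrightarrow> graph_char_poly T =
           \<X> * ((\<X>^2 - \<X> - 1) * (\<X>^2 + \<X> - 1))^(n4 - 1) * quad a b * quad' a b) \<and>
        (\<forall>n4. family3 T a b n4 \<longrightarrow> graph_char_poly T =
           \<X> * (\<X>^2 - 2) * ((\<X>^2 - \<X> - 1) * (\<X>^2 + \<X> - 1))^(n4 - 1) * quad a b * quad' a b) \<and>
        (\<forall>n1 n3. family4 T a b n1 n3 \<longrightarrow> graph_char_poly T =
           \<X>^(n1 + n3 - 1) * (\<X>^2 - 2)^(n3 - 1) * quad a b * quad' a b) \<and>
        (\<forall>n1 n2. family5 T a b n1 n2 \<longrightarrow> graph_char_poly T =
           \<X>^(n1 - 1) * (\<X>^2 - 1)^(n2 - 1) * quad a b * quad' a b))"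
proof (intro conjI)
  obtain ns where T: "is_T T ns"
    using assms(3) by (auto simp: starlike_tree_def)
  show "form_II T \<longleftrightarrow>
       (\<exists>a b. admissible a b \<and>
          ((\<exists>n5. family1 T a b n5) \<or>
           (\<exists>n4. family2 T a b n4) \<or>
           (\<exists>n4. family3 T a b n4) \<or>
           (\<exists>n1 n3. family4 T a b n1 n3) \<or>
           (\<exists>n1 n2. family5 T a b n1 n2)))"
    using form_II_imp_family[OF T induced_K13_branches[OF T assms(5)]] family_imp_form_II by blast
  \<comment> \<open>The displayed products omit the factors with exponent 0 and write those with
    exponent 1 without a power.\<close>
  note unit = power_0 power_one_right mult_1_left mult_1_right mult.assoc
  show "\<forall>a b. admissible a b \<longrightarrow>
        (\<forall>n5. family1 T a b n5 \<longrightarrow> graph_char_poly T =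
           \<X>^n5 * (\<X>^2 - 1)^(n5 - 1) * (\<X>^2 - \<X> - 1) * (\<X>^2 + \<X> - 1) * (\<X>^2 - 3)^(n5 - 1)
             * quad a b * quad' a b) \<and>
        (\<forall>n4. family2 T a b n4 \<longrightarrow> graph_char_poly T =
           \<X> * ((\<X>^2 - \<X> - 1) * (\<X>^2 + \<X> - 1))^(n4 - 1) * quad a b * quad' a b) \<and>
        (\<forall>n4. family3 T a b n4 \<longrightarrow> graph_char_poly T =
           \<X> * (\<X>^2 - 2) * ((\<X>^2 - \<X> - 1) * (\<X>^2 + \<X> - 1))^(n4 - 1) * quad a b * quad' a b) \<and>
        (\<forall>n1 n3. family4 T a b n1 n3 \<longrightarrow> graph_char_poly T =
           \<X>^(n1 + n3 - 1) * (\<X>^2 - 2)^(n3 - 1) * quad a b * quad' a b) \<and>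
        (\<forall>n1 n2. family5 T a b n1 n2 \<longrightarrow> graph_char_poly T =
           \<X>^(n1 - 1) * (\<X>^2 - 1)^(n2 - 1) * quad a b * quad' a b)"
    by (intro allI impI conjI;
        (drule graph_char_poly_family1 graph_char_poly_family2 graph_char_poly_family3
          graph_char_poly_family4 graph_char_poly_family5;
         simp only: form_II_poly_eq[symmetric] unit))
qed

end
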